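(* Let $\lambda$ be a partition of $n$ and $\lambda'$ its conjugate. Let $\mathcal B_\lambda$ be the Boolean (coordinate) arrangement of hyperplanes in the space $M^{\lambda'}$ of the induced representation $\xi_{\lambda'}$ of $\mathfrak S_n$, and let $V_\lambda\subset M^{\lambda'}$ be the subspace of the irreducible representation $\pi_\lambda$ (which occurs in $\xi_{\lambda'}$ with multiplicity one). Then the restriction of $\mathcal B_\lambda$ to $V_\lambda$, i.e. $\{B\cap V_\lambda: B\in\mathcal B_\lambda\}$, coincides with the intrinsic arrangement $\mathcal A_\lambda$ in $V_\lambda$.
   Context: $\mathfrak S_n$ is the symmetric group on $[n]=\{1,\dots,n\}$; $\pi_\lambda$ is its irreducible complex representation with Young diagram $\lambda$ (so $\pi_{(n)}$ is trivial). Intrinsic arrangement. Let $V_\lambda$ be any realization of $\pi_\lambda$. A set partition $\alpha$ of $[n]$ is of type $\mu$ if its block sizes form the partition $\mu$ of $n$; $\mathfrak S_\alpha\subset\mathfrak S_n$ is the Young subgroup of permutations preserving every block of $\alpha$. For $\alpha$ of type $\lambda'$ put $H_\alpha=\sum_{\tau\in T}V_\lambda^\tau$, where $T$ is any set of transpositions generating $\mathfrak S_\alpha$ and $V_\lambda^\tau$ is the subspace of $\tau$-fixed vectors; $H_\alpha$ is a hyperplane independent of the choice of $T$. Then $\mathcal A_\lambda=\{H_\alpha\}$, where $\alpha$ ranges over all set partitions of $[n]$ of type $\lambda'$. The representation $\xi_{\lambda'}$. Write $\lambda'=(1^{m_1}2^{m_2}\dots n^{m_n})$, where $m_k$ is the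 number of parts equal to $k$. Let $W_{\lambda'}=(\mathfrak S_1\wr\mathfrak S_{m_1})\times(\mathfrak S_2\wr\mathfrak S_{m_2})\times\dots\times(\mathfrak S_n\wr\mathfrak S_{m_n})\subset\mathfrak S_n$, which is the stabilizer of a fixed set partition of $[n]$ of type $\lambda'$; here $\mathfrak S_k\wr\mathfrak S_{m_k}$ consists of the elements $(\sigma_1,\dots,\sigma_{m_k};\rho)$ with $\sigma_i\in\mathfrak S_k$ acting inside the $m_k$ blocks of size $k$ and $\rho\in\mathfrak S_{m_k}$ permuting these blocks via fixed (e.g. order-preserving) identifications of the blocks. Let $\operatorname{sgn}_k\wr\operatorname{id}_{m_k}$ be the one-dimensional representation $(\sigma_1,\dots,\sigma_{m_k};\rho)\mapsto\prod_i\operatorname{sgn}(\sigma_i)$, and let $$\xi_{\lambda'}=\operatorname{Ind}_{W_{\lambda'}}^{\mathfrak S_n}\big((\operatorname{sgn}_1\wr\operatorname{id}_{m_1})\times\dots\times(\operatorname{sgn}_n\wr\operatorname{id}_{m_n})\big),$$ realized in a space denoted $M^{\lambda'}$. It has a standard basis $\{g\otimes 1\}$, with $g$ running over representatives of the cosets in $\mathfrak S_n/W_{\lambda'}$ (a different choice of representatives only changes basis vectors by signs). The coordinate arrangement $\mathcal B_\lambda$ consists of the hyperplanes in $M^{\lambda'}$ on which one of the coordinates with respect to this basis vanishes. *)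

theory Defs
  imports
    Complex_Main
    "HOL-Library.Function_Algebras"
    "HOL-Library.Disjoint_Sets"
    "HOL-Library.Multiset"
    "HOL-Combinatorics.Permutations"
    "HOL-Algebra.Sym_Groups"
begin

section \<open>Complex vector spaces of functions\<close>

definition scale_fun :: "('c \<Rightarrow> 'b \<Rightarrow> 'b) \<Rightarrow> 'c \<Rightarrow> ('a \<Rightarrow> 'b) \<Rightarrow> 'a \<Rightarrow> 'b"
  where "scale_fun s c f = (\<lambda>x. s c (f x))"

lemma vector_space_scale_fun:
  assumes "vector_space s"
  shows "vector_space (scale_fun s)"
proof -
  interpret vector_space s by fact
  show ?thesis
    by unfold_locales
      (auto simp: scale_fun_def fun_eq_iff scale_left_distrib scale_right_distrib)
qed

abbreviation cscale :: "complex \<Rightarrow> ('a \<Rightarrow> complex) \<Rightarrow> 'a \<Rightarrow> complex"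
  where "cscale \<equiv> scale_fun (*)"

global_interpretation cfun: vector_space "cscale :: complex \<Rightarrow> ('a \<Rightarrow> complex) \<Rightarrow> 'a \<Rightarrow> complex"
  by (rule vector_space_scale_fun) (unfold_locales, auto simp: algebra_simps)


section \<open>Representations\<close>

text \<open>
  A representation of \<open>G\<close> is given by a subspace \<open>V\<close> of some function space together with the
  operators \<open>\<rho> g\<close>, of which only the values on \<open>V\<close> for \<open>g \<in> carrier G\<close> matter.
\<close>

definition subrepresentation ::
    "('g, 'm) monoid_scheme \<Rightarrow> ('a \<Rightarrow> complex) set \<Rightarrow> ('g \<Rightarrow> ('a \<Rightarrow> complex) \<Rightarrow> 'a \<Rightarrow> complex)
      \<Rightarrow> ('a \<Rightarrow> complex) set \<Rightarrow> bool"
  where "subrepresentation G M \<rho> V \<longleftrightarrow>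
    cfun.subspace V \<and> V \<subseteq> M \<and> (\<forall>g\<in>carrier G. \<forall>v\<in>V. \<rho> g v \<in> V)"

text \<open>
  Intertwining operators are normalised to vanish outside their domain, so that they form a
  vector space with pointwise operations.
\<close>

definition intertwiners ::
    "('g, 'm) monoid_scheme
      \<Rightarrow> ('a \<Rightarrow> complex) set \<Rightarrow> ('g \<Rightarrow> ('a \<Rightarrow> complex) \<Rightarrow> 'a \<Rightarrow> complex)
      \<Rightarrow> ('b \<Rightarrow> complex) set \<Rightarrow> ('g \<Rightarrow> ('b \<Rightarrow> complex) \<Rightarrow> 'b \<Rightarrow> complex)
      \<Rightarrow> (('a \<Rightarrow> complex) \<Rightarrow> 'b \<Rightarrow> complex) set"
  where "intertwiners G V \<rho> W \<sigma> =
    {f. (\<forall>v\<in>V. f v \<in> W) \<and>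
        (\<forall>u\<in>V. \<forall>v\<in>V. f (u + v) = f u + f v) \<and>
        (\<forall>c. \<forall>v\<in>V. f (cscale c v) = cscale c (f v)) \<and>
        (\<forall>g\<in>carrier G. \<forall>v\<in>V. f (\<rho> g v) = \<sigma> g (f v)) \<and>
        (\<forall>v. v \<notin> V \<longrightarrow> f v = 0)}"

definition isomorphic_representations ::
    "('g, 'm) monoid_scheme
      \<Rightarrow> ('a \<Rightarrow> complex) set \<Rightarrow> ('g \<Rightarrow> ('a \<Rightarrow> complex) \<Rightarrow> 'a \<Rightarrow> complex)
      \<Rightarrow> ('b \<Rightarrow> complex) set \<Rightarrow> ('g \<Rightarrow> ('b \<Rightarrow> complex) \<Rightarrow> 'b \<Rightarrow> complex) \<Rightarrow> bool"
  where "isomorphic_representations G V \<rho> W \<sigma> \<longleftrightarrow>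
    (\<exists>f\<in>intertwiners G V \<rho> W \<sigma>. bij_betw f V W)"

text \<open>
  For irreducible \<open>(V, \<rho>)\<close>, the multiplicity of \<open>(V, \<rho>)\<close> in \<open>(W, \<sigma>)\<close> is \<open>dim Hom(V, W)\<close>
  over the group.
\<close>

definition multiplicity_in ::
    "('g, 'm) monoid_scheme
      \<Rightarrow> ('a \<Rightarrow> complex) set \<Rightarrow> ('g \<Rightarrow> ('a \<Rightarrow> complex) \<Rightarrow> 'a \<Rightarrow> complex)
      \<Rightarrow> ('b \<Rightarrow> complex) set \<Rightarrow> ('g \<Rightarrow> ('b \<Rightarrow> complex) \<Rightarrow> 'b \<Rightarrow> complex) \<Rightarrow> nat"
  where "multiplicity_in G V \<rho> W \<sigma> =
    vector_space.dim (scale_fun cscale) (intertwiners G V \<rho> W \<sigma>)"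


section \<open>Integer partitions, set partitions and Young subgroups\<close>

definition integer_partition :: "nat \<Rightarrow> nat list \<Rightarrow> bool"
  where "integer_partition n lam \<longleftrightarrow>
    sorted_wrt (\<ge>) lam \<and> (\<forall>k\<in>set lam. 0 < k) \<and> sum_list lam = n"

definition conjugate :: "nat list \<Rightarrow> nat list"
  where "conjugate lam =
    map (\<lambda>j. length (filter (\<lambda>k. j < k) lam)) [0..<(if lam = [] then 0 else hd lam)]"

definition set_partitions :: "nat \<Rightarrow> nat list \<Rightarrow> nat set set set"
  where "set_partitions n mu =
    {\<alpha>. partition_on {1..n} \<alpha> \<and> image_mset card (mset_set \<alpha>) = mset mu}"

definition young_subgroup :: "nat \<Rightarrow> nat set set \<Rightarrow> (nat \<Rightarrow> nat) set"
  where "young_subgroup n \<alpha> = {p \<in> carrier (sym_group n). \<forall>B\<in>\<alpha>. p ` B = B}"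

definition transpositions :: "nat \<Rightarrow> (nat \<Rightarrow> nat) set"
  where "transpositions n = {transpose a b | a b. a \<in> {1..n} \<and> b \<in> {1..n} \<and> a \<noteq> b}"


section \<open>Specht modules\<close>

text \<open>
  The irreducible representation with Young diagram \<open>lam\<close> is realised as the Specht module, in
  the convention in which the diagram with a single row gives the trivial representation.
  Rows and columns are numbered from 0. A tabloid is the list of its rows, as sets.
\<close>

definition boxes :: "nat list \<Rightarrow> (nat \<times> nat) set"
  where "boxes lam = {(i, j). i < length lam \<and> j < lam ! i}"

definition tableaux :: "nat \<Rightarrow> nat list \<Rightarrow> (nat \<times> nat \<Rightarrow> nat) set"
  where "tableaux n lam = {t. bij_betw t (boxes lam) {1..n}}"

definition tabloid :: "nat list \<Rightarrow> (nat \<times> nat \<Rightarrow> nat) \<Rightarrow> nat set list"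
  where "tabloid lam t = map (\<lambda>i. t ` {b \<in> boxes lam. fst b = i}) [0..<length lam]"

definition column_group :: "nat \<Rightarrow> nat list \<Rightarrow> (nat \<times> nat \<Rightarrow> nat) \<Rightarrow> (nat \<Rightarrow> nat) set"
  where "column_group n lam t =
    {p \<in> carrier (sym_group n).
      \<forall>j. p ` t ` {b \<in> boxes lam. snd b = j} = t ` {b \<in> boxes lam. snd b = j}}"

definition tabloid_vector :: "nat set list \<Rightarrow> nat set list \<Rightarrow> complex"
  where "tabloid_vector T = (\<lambda>S. if S = T then 1 else 0)"

definition polytabloid :: "nat \<Rightarrow> nat list \<Rightarrow> (nat \<times> nat \<Rightarrow> nat) \<Rightarrow> nat set list \<Rightarrow> complex"
  where "polytabloid n lam t =
    (\<Sum>p\<in>column_group n lam t. cscale (of_int (sign p)) (tabloid_vector (tabloid lam (p \<circ> t))))"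

definition specht :: "nat \<Rightarrow> nat list \<Rightarrow> (nat set list \<Rightarrow> complex) set"
  where "specht n lam = cfun.span (polytabloid n lam ` tableaux n lam)"

text \<open>The linear action that maps the basis vector of a tabloid \<open>T\<close> to that of \<open>p T\<close>.\<close>

definition tabloid_action ::
    "(nat \<Rightarrow> nat) \<Rightarrow> (nat set list \<Rightarrow> complex) \<Rightarrow> nat set list \<Rightarrow> complex"
  where "tabloid_action p f = (\<lambda>T. f (map ((`) (inv' p)) T))"


section \<open>The intrinsic arrangement\<close>

text \<open>
  The sum of the fixed subspaces is the span of their union. The sum does not depend on the
  generating set \<open>T\<close>; all generating sets of transpositions are admitted.
\<close>

definition fixed_sum ::
    "('a \<Rightarrow> complex) set \<Rightarrow> ('g \<Rightarrow> ('a \<Rightarrow> complex) \<Rightarrow> 'a \<Rightarrow> complex) \<Rightarrow> 'g set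
      \<Rightarrow> ('a \<Rightarrow> complex) set"
  where "fixed_sum V \<rho> T = cfun.span (\<Union>\<tau>\<in>T. {v \<in> V. \<rho> \<tau> v = v})"

definition intrinsic_arrangement ::
    "nat \<Rightarrow> nat list \<Rightarrow> ('a \<Rightarrow> complex) set \<Rightarrow> ((nat \<Rightarrow> nat) \<Rightarrow> ('a \<Rightarrow> complex) \<Rightarrow> 'a \<Rightarrow> complex)
      \<Rightarrow> ('a \<Rightarrow> complex) set set"
  where "intrinsic_arrangement n lam V \<rho> =
    {fixed_sum V \<rho> T | \<alpha> T.
      \<alpha> \<in> set_partitions n (conjugate lam) \<and>
      T \<subseteq> transpositions n \<and> generate (sym_group n) T = young_subgroup n \<alpha>}"


section \<open>Representations induced from a linear character\<close>

text \<open>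
  For a linear character \<open>\<chi>\<close> of a subgroup \<open>W\<close> of a finite group \<open>G\<close>, the function \<open>f\<close> stands for
  the element \<open>\<Sum>g\<in>R. f(g) (g \<otimes> 1)\<close> of the induced module, where \<open>R\<close> is a set of representatives
  of the cosets \<open>g W\<close>; since \<open>gw \<otimes> 1 = \<chi>(w) (g \<otimes> 1)\<close>, this does not depend on \<open>R\<close>.
\<close>

definition induced_space ::
    "('g, 'm) monoid_scheme \<Rightarrow> 'g set \<Rightarrow> ('g \<Rightarrow> complex) \<Rightarrow> ('g \<Rightarrow> complex) set"
  where "induced_space G W \<chi> =
    {f. (\<forall>g. g \<notin> carrier G \<longrightarrow> f g = 0) \<and>
        (\<forall>g\<in>carrier G. \<forall>w\<in>W. f (g \<otimes>\<^bsub>G\<^esub> w) = inverse (\<chi> w) * f g)}"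

definition induced_action ::
    "('g, 'm) monoid_scheme \<Rightarrow> 'g \<Rightarrow> ('g \<Rightarrow> complex) \<Rightarrow> 'g \<Rightarrow> complex"
  where "induced_action G h f =
    (\<lambda>g. if g \<in> carrier G then f (inv\<^bsub>G\<^esub> h \<otimes>\<^bsub>G\<^esub> g) else 0)"

text \<open>The vector \<open>g \<otimes> 1\<close>.\<close>

definition induced_basis_vector ::
    "('g, 'm) monoid_scheme \<Rightarrow> 'g set \<Rightarrow> ('g \<Rightarrow> complex) \<Rightarrow> 'g \<Rightarrow> 'g \<Rightarrow> complex"
  where "induced_basis_vector G W \<chi> g =
    (\<lambda>x. if x \<in> g <#\<^bsub>G\<^esub> W then inverse (\<chi> (inv\<^bsub>G\<^esub> g \<otimes>\<^bsub>G\<^esub> x)) else 0)"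

definition coset_representatives :: "('g, 'm) monoid_scheme \<Rightarrow> 'g set \<Rightarrow> 'g set \<Rightarrow> bool"
  where "coset_representatives G W R \<longleftrightarrow>
    R \<subseteq> carrier G \<and> (\<forall>x\<in>carrier G. \<exists>!g. g \<in> R \<and> x \<in> g <#\<^bsub>G\<^esub> W)"

definition coordinate_arrangement ::
    "('g, 'm) monoid_scheme \<Rightarrow> 'g set \<Rightarrow> ('g \<Rightarrow> complex) \<Rightarrow> 'g set \<Rightarrow> ('g \<Rightarrow> complex) set set"
  where "coordinate_arrangement G W \<chi> R =
    {{f \<in> induced_space G W \<chi>.
        cfun.representation (induced_basis_vector G W \<chi> ` R) f (induced_basis_vector G W \<chi> g) = 0}
      | g. g \<in> R}"

definition restriction :: "'v set set \<Rightarrow> 'v set \<Rightarrow> 'v set set"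
  where "restriction \<B> V = {B \<inter> V | B. B \<in> \<B>}"


section \<open>The representation induced from the stabilizer of a set partition\<close>

definition stabilizer :: "nat \<Rightarrow> nat set set \<Rightarrow> (nat \<Rightarrow> nat) set"
  where "stabilizer n \<alpha> = {p \<in> carrier (sym_group n). (`) p ` \<alpha> = \<alpha>}"

text \<open>
  A labelling identifies every block with an initial segment of the natural numbers, and
  thereby all blocks of equal size with each other.
\<close>

definition block_labelling :: "nat set set \<Rightarrow> (nat set \<Rightarrow> nat \<Rightarrow> nat) \<Rightarrow> bool"
  where "block_labelling \<alpha> \<iota> \<longleftrightarrow> (\<forall>B\<in>\<alpha>. bij_betw (\<iota> B) {..<card B} B)"

text \<open>
  The component at the block \<open>B\<close> of a stabilizing permutation \<open>w\<close>, viewed as an element of a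
  product of wreath products: in terms of the labels, \<open>w\<close> restricts to a bijection from \<open>B\<close> to
  the block \<open>w ` B\<close>.
\<close>

definition block_component ::
    "(nat set \<Rightarrow> nat \<Rightarrow> nat) \<Rightarrow> (nat \<Rightarrow> nat) \<Rightarrow> nat set \<Rightarrow> nat \<Rightarrow> nat"
  where "block_component \<iota> w B =
    (\<lambda>j. if j < card B then the_inv_into {..<card B} (\<iota> (w ` B)) (w (\<iota> B j)) else j)"

definition wreath_character ::
    "nat set set \<Rightarrow> (nat set \<Rightarrow> nat \<Rightarrow> nat) \<Rightarrow> (nat \<Rightarrow> nat) \<Rightarrow> complex"
  where "wreath_character \<alpha> \<iota> w = (\<Prod>B\<in>\<alpha>. of_int (sign (block_component \<iota> w B)))"

abbreviation xi_space ::
    "nat \<Rightarrow> nat set set \<Rightarrow> (nat set \<Rightarrow> nat \<Rightarrow> nat) \<Rightarrow> ((nat \<Rightarrow> nat) \<Rightarrow> complex) set"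
  where "xi_space n \<alpha> \<iota> \<equiv>
    induced_space (sym_group n) (stabilizer n \<alpha>) (wreath_character \<alpha> \<iota>)"

abbreviation xi_action ::
    "nat \<Rightarrow> (nat \<Rightarrow> nat) \<Rightarrow> ((nat \<Rightarrow> nat) \<Rightarrow> complex) \<Rightarrow> (nat \<Rightarrow> nat) \<Rightarrow> complex"
  where "xi_action n \<equiv> induced_action (sym_group n)"

abbreviation xi_coordinate_arrangement ::
    "nat \<Rightarrow> nat set set \<Rightarrow> (nat set \<Rightarrow> nat \<Rightarrow> nat) \<Rightarrow> (nat \<Rightarrow> nat) set
      \<Rightarrow> ((nat \<Rightarrow> nat) \<Rightarrow> complex) set set"
  where "xi_coordinate_arrangement n \<alpha> \<iota> R \<equiv>
    coordinate_arrangement (sym_group n) (stabilizer n \<alpha>) (wreath_character \<alpha> \<iota>) R"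

text \<open>
  \<open>V\<close> is a subspace of the induced representation realising the irreducible representation
  with Young diagram \<open>lam\<close>.
\<close>

definition is_pi_subspace ::
    "nat \<Rightarrow> nat list \<Rightarrow> nat set set \<Rightarrow> (nat set \<Rightarrow> nat \<Rightarrow> nat)
      \<Rightarrow> ((nat \<Rightarrow> nat) \<Rightarrow> complex) set \<Rightarrow> bool"
  where "is_pi_subspace n lam \<alpha> \<iota> V \<longleftrightarrow>
    subrepresentation (sym_group n) (xi_space n \<alpha> \<iota>) (xi_action n) V \<and>
    isomorphic_representations (sym_group n) V (xi_action n) (specht n lam) tabloid_action"

end

theory Submission
  imports Defs
begin

text \<open>
  Identify the blocks of \<open>\<alpha>\<close> with the columns of a tableau \<open>t\<close>, so that the column group of \<open>t\<close>
  is the Young subgroup of \<open>\<alpha>\<close>. On the Specht module \<open>S\<close> the antisymmetrizer of \<open>t\<close> is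
  \<open>v \<mapsto> \<langle>v, e\<^sub>t\<rangle> e\<^sub>t\<close>, and the stabilizer of \<open>\<alpha>\<close> acts on \<open>e\<^sub>t\<close> through the wreath character.
  Hence \<open>v \<mapsto> (g \<mapsto> \<langle>v, g e\<^sub>t\<rangle>)\<close> embeds \<open>S\<close> into the induced representation, and by Frobenius
  reciprocity it is up to scalars the only intertwiner. In these terms the coordinate hyperplane at
  \<open>g\<close> is the kernel of the antisymmetrizer of the Young subgroup of \<open>g \<alpha>\<close>. For any generating set
  of transpositions this kernel is the sum of the fixed spaces, because modulo that sum the
  Young subgroup acts by the sign.
\<close>

text \<open>The label of an entry inside its block serves as its row number in \<open>t\<close>.
  This is where the wreath character comes from: moving blocks of equal size onto each other with
  labels kept permutes entries within rows, which a tabloid does not see, so only the label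
  permutations inside the blocks leave a sign. The rank-one form of the antisymmetrizer is used
  three times: it makes the pairing transform by the character under the stabilizer, it pins down
  every intertwiner by one scalar, and on the embedded copy of \<open>S\<close> it turns the kernel
  of an antisymmetrizer into the vanishing of the single value \<open>F g\<close>. Injectivity of
  the embedding is of another nature and rests on positivity of the Hermitian form on functions of
  tabloids.\<close>

declare One_nat_def [simp del] \<comment> \<open>keeps \<open>{1..n}\<close> from turning into \<open>{Suc 0..n}\<close>\<close>


section \<open>Young diagrams\<close>

text \<open>When a new maximum b is added, all earlier elements lie below b, so b is at least their
  number, which is the new term of the initial segment. The equality clause is what later forces the
  rows of a column to fill up without gaps.\<close>

lemma sum_lessThan_card_le:
  fixes A :: "nat set"
  assumes "finite A"
  shows "\<Sum>{..<card A} \<le> \<Sum>A \<and> (\<Sum>A = \<Sum>{..<card A} \<longrightarrow> A = {..<card A})"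
  using assms
proof (induction A rule: finite_linorder_max_induct)
  case (insert b A)
  then have nb: "b \<notin> A" by auto
  have "A \<subseteq> {..<b}" using insert by auto
  then have "card A \<le> b" using card_mono[of "{..<b}" A] by simp
  moreover have "\<Sum>{..<card (insert b A)} = \<Sum>{..<card A} + card A"
    and "\<Sum>(insert b A) = \<Sum>A + b" and card: "card (insert b A) = Suc (card A)"
    using insert nb by auto
  ultimately have "\<Sum>{..<card (insert b A)} \<le> \<Sum>(insert b A)"
    and "\<Sum>(insert b A) = \<Sum>{..<card (insert b A)} \<Longrightarrow> \<Sum>A = \<Sum>{..<card A} \<and> b = card A"
    using insert.IH by linarith+
  then show ?case
    using insert.IH card lessThan_Suc by metis
qed simp

lemma finite_boxes [simp]: "finite (boxes lam)"
proof -
  have "boxes lam = (SIGMA i:{..<length lam}. {..<lam ! i})"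
    by (auto simp: boxes_def)
  then show ?thesis by simp
qed

lemma boxes_upward:
  assumes "integer_partition n lam" "(i, j) \<in> boxes lam" "i' \<le> i"
  shows "(i', j) \<in> boxes lam"
proof -
  have "lam ! i \<le> lam ! i'"
    using assms unfolding integer_partition_def boxes_def
    by (cases "i' = i") (auto simp: sorted_wrt_iff_nth_less)
  then show ?thesis using assms by (auto simp: boxes_def)
qed

text \<open>In a decreasing list the entries above a threshold form a prefix, so counting them
  amounts to comparing indices. This makes \<open>conjugate\<close> the list of column
  heights.\<close>

lemma length_filter_less_iff:
  assumes "sorted_wrt (\<ge>) (lam :: nat list)"
  shows "i < length (filter (\<lambda>k. j < k) lam) \<longleftrightarrow> i < length lam \<and> j < lam ! i"
  using assms
proof (induction lam arbitrary: i)
  case (Cons a lam)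
  show ?case
  proof (cases "j < a")
    case True
    then show ?thesis using Cons by (cases i) auto
  next
    case False
    then have "filter (\<lambda>k. j < k) lam = []"
      using Cons.prems by (force simp: filter_empty_conv)
    moreover have "\<forall>i < length lam. \<not> j < lam ! i"
      using Cons.prems False by (auto simp: all_set_conv_all_nth)
    ultimately show ?thesis using False by (cases i) auto
  qed
qed simp

lemma boxes_conjugate:
  assumes "integer_partition n lam"
  shows "boxes lam = {(i, j). j < length (conjugate lam) \<and> i < conjugate lam ! j}"
proof -
  have s: "sorted_wrt (\<ge>) lam" using assms by (simp add: integer_partition_def)
  have le: "lam ! i \<le> hd lam" if "i < length lam" for i
    using that s by (cases lam; cases i) auto
  have "(i, j) \<in> boxes lam \<longleftrightarrow> j < length (conjugate lam) \<and> i < conjugate lam ! j" for i j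
    using le[of i] length_filter_less_iff[OF s, of i j]
    by (auto simp: boxes_def conjugate_def)
  then show ?thesis by auto
qed

text \<open>A column is closed under moving up, hence an initial segment of row numbers. In this
  form its sum of row numbers is the minimum in \<open>sum_lessThan_card_le\<close>.\<close>

lemma column_boxes:
  assumes "integer_partition n lam"
  shows "{i. (i, j) \<in> boxes lam} = {..<card {i. (i, j) \<in> boxes lam}}" (is "?K = _")
proof -
  have fin: "finite ?K"
    by (rule finite_subset[of _ "fst ` boxes lam"]) force+
  show ?thesis
  proof (cases "?K = {}")
    case False
    define m where "m = Max ?K"
    have "m \<in> ?K" unfolding m_def using fin False by (rule Max_in)
    moreover have "i \<le> m" if "i \<in> ?K" for i
      unfolding m_def using fin that by (rule Max_ge)
    ultimately have "?K = {..<Suc m}"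
      using boxes_upward[OF assms, of m j] by (auto simp: less_Suc_eq_le)
    then show ?thesis by (rule ssubst) simp
  qed simp
qed


section \<open>Tableaux and column groups\<close>

lemma tableauxD:
  assumes "t \<in> tableaux n lam"
  shows "bij_betw t (boxes lam) {1..n}"
  using assms by (simp add: tableaux_def)

lemma comp_in_tableaux:
  assumes "t \<in> tableaux n lam" "p permutes {1..n}"
  shows "p \<circ> t \<in> tableaux n lam"
  using assms by (auto simp: tableaux_def intro: bij_betw_trans permutes_imp_bij)

lemma tabloid_cong:
  assumes "\<And>b. b \<in> boxes lam \<Longrightarrow> s b = t b"
  shows "tabloid lam s = tabloid lam t"
  using assms by (auto simp: tabloid_def intro!: map_cong image_cong)

lemma tabloid_comp: "tabloid lam (p \<circ> t) = map ((`) p) (tabloid lam t)"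
  by (auto simp: tabloid_def image_comp)

lemma column_groupD:
  assumes "p \<in> column_group n lam t"
  shows "p permutes {1..n}"
    and "\<And>j. p ` t ` {b \<in> boxes lam. snd b = j} = t ` {b \<in> boxes lam. snd b = j}"
  using assms by (auto simp: column_group_def sym_group_carrier)

lemma finite_column_group [simp]: "finite (column_group n lam t)"
  by (rule finite_subset[OF _ finite_permutations[of "{1..n}"]])
    (auto simp: column_group_def sym_group_carrier)

lemma id_in_column_group [simp]: "id \<in> column_group n lam t"
  by (auto simp: column_group_def sym_group_carrier permutes_id)

lemma column_group_comp:
  assumes "p \<in> column_group n lam t" "q \<in> column_group n lam t"
  shows "p \<circ> q \<in> column_group n lam t"
proof -
  note p = column_groupD[OF assms(1)] and q = column_groupD[OF assms(2)]
  have "(p \<circ> q) ` t ` {b \<in> boxes lam. snd b = j} = t ` {b \<in> boxes lam. snd b = j}" for j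
    unfolding image_comp[symmetric, of p q] q(2) p(2) ..
  then show ?thesis
    using permutes_compose[OF q(1) p(1)] by (simp add: column_group_def sym_group_carrier)
qed

lemma column_group_inv:
  assumes "p \<in> column_group n lam t"
  shows "inv' p \<in> column_group n lam t"
proof -
  note p = column_groupD[OF assms]
  have "inv' p ` t ` {b \<in> boxes lam. snd b = j} = t ` {b \<in> boxes lam. snd b = j}" for j
    using image_inv_f_f[OF permutes_inj[OF p(1)], of "t ` {b \<in> boxes lam. snd b = j}"]
    unfolding p(2) .
  then show ?thesis
    by (simp add: column_group_def sym_group_carrier permutes_inv[OF p(1)])
qed

lemma transpose_in_column_group:
  assumes t: "t \<in> tableaux n lam" and b: "b \<in> boxes lam" "c \<in> boxes lam" "snd b = snd c"
  shows "transpose (t b) (t c) \<in> column_group n lam t"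
proof -
  have tb: "t b \<in> {1..n}" "t c \<in> {1..n}"
    using b tableauxD[OF t] by (auto dest: bij_betwE)
  have "transpose (t b) (t c) ` t ` {b \<in> boxes lam. snd b = j} = t ` {b \<in> boxes lam. snd b = j}" for j
  proof (cases "j = snd b")
    case True
    then have "transpose (t b) (t c) permutes (t ` {b \<in> boxes lam. snd b = j})"
      using b by (intro permutes_swap_id) auto
    then show ?thesis by (rule permutes_image)
  next
    case False
    have "transpose (t b) (t c) (t a) = t a" if "a \<in> boxes lam" "snd a = j" for a
      using that b False tableauxD[OF t]
      by (intro transpose_apply_other) (auto simp: bij_betw_def inj_on_eq_iff)
    then show ?thesis by (auto simp: image_image)
  qed
  then show ?thesis
    using tb by (simp add: column_group_def sym_group_carrier permutes_swap_id)
qed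

text \<open>Every entry keeps its column because p is in the column group, and its row because the
  tabloid is unchanged; row and column determine the box.\<close>

lemma column_group_tabloid_eq_imp_id:
  assumes t: "t \<in> tableaux n lam" and p: "p \<in> column_group n lam t"
    and eq: "tabloid lam (p \<circ> t) = tabloid lam t"
  shows "p = id"
proof
  fix x
  note bij = tableauxD[OF t] and p' = column_groupD[OF p]
  show "p x = id x"
  proof (cases "x \<in> {1..n}")
    case True
    then have "x \<in> t ` boxes lam" using bij by (simp add: bij_betw_def)
    then obtain b where b: "b \<in> boxes lam" "x = t b" by blast
    have "p x \<in> t ` {a \<in> boxes lam. snd a = snd b}" using p'(2)[of "snd b"] b by blast
    then obtain c where c: "c \<in> boxes lam" "snd c = snd b" "p x = t c" by auto
    have "(p \<circ> t) ` {a \<in> boxes lam. fst a = fst b} = t ` {a \<in> boxes lam. fst a = fst b}"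
    proof -
      have "fst b < length lam" using b(1) by (auto simp: boxes_def)
      then have "tabloid lam (p \<circ> t) ! fst b = (p \<circ> t) ` {a \<in> boxes lam. fst a = fst b}"
        and "tabloid lam t ! fst b = t ` {a \<in> boxes lam. fst a = fst b}"
        by (simp_all add: tabloid_def)
      then show ?thesis using eq by simp
    qed
    then have "p x \<in> t ` {a \<in> boxes lam. fst a = fst b}" using b by auto
    then have "fst c = fst b"
      using c bij by (auto simp: bij_betw_def inj_on_eq_iff)
    then show ?thesis using b c by (metis prod_eqI id_apply)
  next
    case False
    then show ?thesis using p'(1) by (simp add: permutes_not_in)
  qed
qed

text \<open>
  Move every entry of a column of \<open>t\<close> to the row that it occupies in \<open>s\<close>. In each column the new
  row numbers are distinct, so their sum is at least that of an initial segment; the total over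
  all columns is the same for \<open>s\<close> and \<open>t\<close>, so that all these inequalities are equalities, and the
  entries fill the diagram again.
\<close>

lemma distinct_rows_imp_tabloid_eq:
  assumes ip: "integer_partition n lam" and s: "s \<in> tableaux n lam" and t: "t \<in> tableaux n lam"
    and distinct_rows: "\<And>b c. \<lbrakk>b \<in> boxes lam; c \<in> boxes lam; snd b = snd c;
      fst (inv_into (boxes lam) s (t b)) = fst (inv_into (boxes lam) s (t c))\<rbrakk> \<Longrightarrow> b = c"
  obtains p where "p \<in> column_group n lam t" "tabloid lam (p \<circ> t) = tabloid lam s"
proof -
  note bs = tableauxD[OF s] and bt = tableauxD[OF t]
  define r where "r b = fst (inv_into (boxes lam) s (t b))" for b
  define e where "e b = (r b, snd b)" for b
  have inj: "inj_on e (boxes lam)"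
    unfolding inj_on_def e_def r_def using distinct_rows by auto
  define K where "K j = {i. (i, j) \<in> boxes lam}" for j
  have finK: "finite (K j)" for j
    unfolding K_def by (rule finite_subset[of _ "fst ` boxes lam"]) force+
  define J where "J = snd ` boxes lam"
  have sum_boxes: "(\<Sum>b\<in>boxes lam. f b) = (\<Sum>j\<in>J. \<Sum>i\<in>K j. f (i, j))" for f :: "nat \<times> nat \<Rightarrow> nat"
  proof -
    have "(\<Sum>j\<in>J. \<Sum>i\<in>K j. f (i, j)) = (\<Sum>(j, i)\<in>Sigma J K. f (i, j))"
      using finK by (intro sum.Sigma) (auto simp: J_def)
    also have "\<dots> = (\<Sum>b\<in>boxes lam. f b)"
      by (rule sum.reindex_bij_witness[of _ "\<lambda>b. (snd b, fst b)" "\<lambda>b. (snd b, fst b)"])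
        (auto simp: J_def K_def intro: rev_image_eqI)
    finally show ?thesis by simp
  qed
  define R where "R j = (\<lambda>i. r (i, j)) ` K j" for j
  have injR: "inj_on (\<lambda>i. r (i, j)) (K j)" for j
    using inj by (fastforce simp: inj_on_def e_def K_def)
  have cardR: "card (R j) = card (K j)" for j
    unfolding R_def by (rule card_image[OF injR])
  have K: "K j = {..<card (K j)}" for j
    unfolding K_def by (rule column_boxes[OF ip])
  have le: "\<Sum>(K j) \<le> \<Sum>(R j)" for j
    using sum_lessThan_card_le[of "R j"] finK[of j] K[of j] cardR[of j]
    by (simp add: R_def)
  have "(\<Sum>j\<in>J. \<Sum>(R j)) = (\<Sum>b\<in>boxes lam. r b)"
    unfolding sum_boxes R_def by (simp add: sum.reindex[OF injR])
  \<comment> \<open>Reading an entry off \<open>t\<close> and locating it in \<open>s\<close>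
    permutes the boxes, so the total of the row numbers does not change.\<close>
  also have "\<dots> = (\<Sum>b\<in>boxes lam. fst b)"
    unfolding r_def
    by (rule sum.reindex_bij_betw[of "\<lambda>b. inv_into (boxes lam) s (t b)" _ _ fst])
      (use bij_betw_trans[OF bt bij_betw_inv_into[OF bs]] in \<open>simp add: o_def\<close>)
  also have "\<dots> = (\<Sum>j\<in>J. \<Sum>(K j))"
    unfolding sum_boxes by simp
  finally have sums: "(\<Sum>j\<in>J. \<Sum>(R j)) = (\<Sum>j\<in>J. \<Sum>(K j))" .
  have RK: "R j = K j" if "j \<in> J" for j
  proof -
    have "\<Sum>(R j) = \<Sum>(K j)"
    proof (rule ccontr)
      assume "\<Sum>(R j) \<noteq> \<Sum>(K j)"
      then have "\<Sum>(K j) < \<Sum>(R j)" using le[of j] by simp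
      then have "(\<Sum>j\<in>J. \<Sum>(K j)) < (\<Sum>j\<in>J. \<Sum>(R j))"
        using that le by (intro sum_strict_mono_ex1) (auto simp: J_def)
      then show False using sums by simp
    qed
    then show ?thesis
      using sum_lessThan_card_le[of "R j"] finK[of j] K[of j] cardR[of j]
      by (simp add: R_def)
  qed
  have "e ` boxes lam \<subseteq> boxes lam"
  proof
    fix c assume "c \<in> e ` boxes lam"
    then obtain i j where b: "(i, j) \<in> boxes lam" "c = (r (i, j), j)" by (auto simp: e_def)
    then have "r (i, j) \<in> R j" "j \<in> J" by (auto simp: R_def K_def J_def intro: rev_image_eqI)
    then show "c \<in> boxes lam" using RK[of j] b by (simp add: K_def)
  qed
  then have be: "bij_betw e (boxes lam) (boxes lam)"
    using inj endo_inj_surj[of "boxes lam" e] by (simp add: bij_betw_def)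
  define e' where "e' = inv_into (boxes lam) e"
  have be': "bij_betw e' (boxes lam) (boxes lam)"
    unfolding e'_def by (rule bij_betw_inv_into[OF be])
  have ee': "e (e' b) = b" if "b \<in> boxes lam" for b
    using that be unfolding e'_def by (metis bij_betw_inv_into_right)
  have e'e: "e' (e b) = b" if "b \<in> boxes lam" for b
    using that be unfolding e'_def by (metis bij_betw_inv_into_left)
  have e'_in: "e' b \<in> boxes lam" if "b \<in> boxes lam" for b
    using that be' by (auto dest: bij_betwE)
  have e_in: "e b \<in> boxes lam" if "b \<in> boxes lam" for b
    using that be by (auto dest: bij_betwE)
  have image_e': "e' ` {b \<in> boxes lam. P b} = {b \<in> boxes lam. P (e b)}" for P
  proof (intro Set.set_eqI iffI)
    fix c assume "c \<in> {b \<in> boxes lam. P (e b)}"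
    then show "c \<in> e' ` {b \<in> boxes lam. P b}"
      using e'e e_in by (intro image_eqI[of _ _ "e c"]) auto
  qed (auto simp: e'_in ee')
  \<comment> \<open>The entry wanted in box b is the one that \<open>e\<close> sends there, so p
    uses the inverse of \<open>e\<close>. Outside \<open>{1..n}\<close> it is the identity, as
    \<open>permutes\<close> demands.\<close>
  define p where "p = restrict_id (t \<circ> e' \<circ> inv_into (boxes lam) t) {1..n}"
  have pt: "p (t b) = t (e' b)" if "b \<in> boxes lam" for b
    using that bt bij_betw_inv_into_left[OF bt that] by (auto simp: p_def dest: bij_betwE)
  have "bij_betw (t \<circ> e' \<circ> inv_into (boxes lam) t) {1..n} {1..n}"
    using bt be' by (intro bij_betw_trans[OF bij_betw_inv_into[OF bt]]) (auto intro: bij_betw_trans)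
  then have perm: "p permutes {1..n}"
    unfolding p_def by (rule permutes_restrict_id)
  have "p ` t ` {b \<in> boxes lam. snd b = j} = t ` {b \<in> boxes lam. snd b = j}" for j
  proof -
    have "e' ` {b \<in> boxes lam. snd b = j} = {b \<in> boxes lam. snd b = j}"
      unfolding image_e' by (simp add: e_def)
    moreover have "p ` t ` {b \<in> boxes lam. snd b = j} = t ` e' ` {b \<in> boxes lam. snd b = j}"
      using pt by (force simp: image_image intro!: image_cong)
    ultimately show ?thesis by simp
  qed
  then have "p \<in> column_group n lam t"
    using perm by (simp add: column_group_def sym_group_carrier)
  moreover have "(p \<circ> t) ` {b \<in> boxes lam. fst b = i} = s ` {b \<in> boxes lam. fst b = i}" for i
  proof -
    have "(p \<circ> t) ` {b \<in> boxes lam. fst b = i} = t ` e' ` {b \<in> boxes lam. fst b = i}"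
      using pt by (force simp: image_image intro!: image_cong)
    also have "e' ` {b \<in> boxes lam. fst b = i} = {b \<in> boxes lam. r b = i}"
      unfolding image_e' by (simp add: e_def)
    also have "t ` {b \<in> boxes lam. r b = i} = s ` {b \<in> boxes lam. fst b = i}"
    proof (intro Set.set_eqI iffI)
      fix x assume "x \<in> t ` {b \<in> boxes lam. r b = i}"
      then obtain b where b: "b \<in> boxes lam" "r b = i" "x = t b" by auto
      have "t b \<in> s ` boxes lam" using b bs bt by (auto simp: bij_betw_def)
      then show "x \<in> s ` {b \<in> boxes lam. fst b = i}"
        using b by (intro image_eqI[of _ _ "inv_into (boxes lam) s x"])
          (auto simp: r_def f_inv_into_f inv_into_into)
    next
      fix x assume "x \<in> s ` {b \<in> boxes lam. fst b = i}"
      then obtain b where b: "b \<in> boxes lam" "fst b = i" "x = s b" by auto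
      then have "x \<in> t ` boxes lam" using bs bt by (auto simp: bij_betw_def)
      then obtain c where c: "c \<in> boxes lam" "x = t c" by auto
      then have "r c = i" using b bij_betw_inv_into_left[OF bs b(1)] by (simp add: r_def)
      then show "x \<in> t ` {b \<in> boxes lam. r b = i}" using c by auto
    qed
    finally show ?thesis .
  qed
  then have "tabloid lam (p \<circ> t) = tabloid lam s"
    by (simp add: tabloid_def)
  ultimately show ?thesis by (rule that)
qed


section \<open>Polytabloids\<close>

lemma cscale_apply [simp]: "cscale c f x = c * f x"
  by (simp add: scale_fun_def)

lemma sum_apply: "(\<Sum>a\<in>A. f a) x = (\<Sum>a\<in>A. f a x :: 'c :: comm_monoid_add)"
  by (induction A rule: infinite_finite_induct) auto

lemma tabloid_action_add: "tabloid_action p (f + g) = tabloid_action p f + tabloid_action p g"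
  by (auto simp: tabloid_action_def)

lemma tabloid_action_cscale: "tabloid_action p (cscale c f) = cscale c (tabloid_action p f)"
  by (auto simp: tabloid_action_def)

lemma tabloid_action_zero [simp]: "tabloid_action p 0 = 0"
  by (auto simp: tabloid_action_def)

lemma tabloid_action_sum: "tabloid_action p (\<Sum>a\<in>A. f a) = (\<Sum>a\<in>A. tabloid_action p (f a))"
  by (induction A rule: infinite_finite_induct)
    (simp_all only: sum.infinite sum.empty sum.insert tabloid_action_zero tabloid_action_add simp_thms)

lemma tabloid_action_comp:
  assumes "bij p" "bij q"
  shows "tabloid_action (p \<circ> q) f = tabloid_action p (tabloid_action q f)"
proof -
  have "map ((`) (inv' q)) (map ((`) (inv' p)) T) = map ((`) (inv' (p \<circ> q))) T" for T
    unfolding o_inv_distrib[OF assms] by (simp add: image_image)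
  then show ?thesis unfolding tabloid_action_def by presburger
qed

lemma tabloid_action_vector:
  assumes "bij p"
  shows "tabloid_action p (tabloid_vector T) = tabloid_vector (map ((`) p) T)"
proof
  fix S
  have "map ((`) (inv' p)) S = T \<longleftrightarrow> S = map ((`) p) T"
    using assms
    by (auto simp: o_def image_image bij_is_inj bij_is_surj surj_f_inv_f map_idI)
  then show "tabloid_action p (tabloid_vector T) S = tabloid_vector (map ((`) p) T) S"
    by (simp add: tabloid_action_def tabloid_vector_def)
qed

lemma sign_comp_permutes:
  assumes "p permutes {1..n :: nat}" "q permutes {1..n}"
  shows "sign (p \<circ> q) = sign p * sign q"
  using assms by (intro sign_compose) (auto simp: permutation_permutes)

lemma sign_inv_permutes:
  assumes "p permutes {1..n :: nat}"
  shows "sign (inv' p) = sign p"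
  using assms by (intro sign_inverse) (auto simp: permutation_permutes)

lemma sign_column_group:
  assumes "p \<in> column_group n lam t" "q \<in> column_group n lam t"
  shows "sign (p \<circ> q) = sign p * sign q"
  using assms by (intro sign_comp_permutes) (auto dest: column_groupD)

lemma of_int_sign_mult_self [simp]: "of_int (sign p) * of_int (sign p) = (1 :: complex)"
  by (metis of_int_1 of_int_mult sign_idempotent)

section \<open>The antisymmetrizer of a tableau and the pairing with its polytabloid\<close>

definition antisymmetrize ::
    "nat \<Rightarrow> nat list \<Rightarrow> (nat \<times> nat \<Rightarrow> nat) \<Rightarrow> (nat set list \<Rightarrow> complex) \<Rightarrow> nat set list \<Rightarrow> complex"
  where "antisymmetrize n lam t f =
    (\<Sum>p\<in>column_group n lam t. cscale (of_int (sign p)) (tabloid_action p f))"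

text \<open>This is \<open>\<langle>v, e\<^sub>t\<rangle>\<close> for the form in which the tabloids
  are orthonormal, expanded along the column group. The coefficients of \<open>e\<^sub>t\<close> are
  integers, so no conjugation appears and the pairing is linear in v.\<close>

definition polytabloid_pairing ::
    "nat \<Rightarrow> nat list \<Rightarrow> (nat \<times> nat \<Rightarrow> nat) \<Rightarrow> (nat set list \<Rightarrow> complex) \<Rightarrow> complex"
  where "polytabloid_pairing n lam t v =
    (\<Sum>p\<in>column_group n lam t. of_int (sign p) * v (tabloid lam (p \<circ> t)))"

lemma polytabloid_pairing_add:
  "polytabloid_pairing n lam t (u + v) = polytabloid_pairing n lam t u + polytabloid_pairing n lam t v"
  by (simp add: polytabloid_pairing_def algebra_simps sum.distrib)

lemma polytabloid_pairing_cscale: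
  "polytabloid_pairing n lam t (cscale c v) = c * polytabloid_pairing n lam t v"
  by (simp add: polytabloid_pairing_def sum_distrib_left algebra_simps)

lemma antisymmetrize_add:
  "antisymmetrize n lam t (f + g) = antisymmetrize n lam t f + antisymmetrize n lam t g"
  by (simp add: antisymmetrize_def tabloid_action_add cfun.scale_right_distrib sum.distrib)

lemma antisymmetrize_cscale:
  "antisymmetrize n lam t (cscale c f) = cscale c (antisymmetrize n lam t f)"
  by (simp add: antisymmetrize_def tabloid_action_cscale cfun.scale_sum_right mult.commute)

lemma antisymmetrize_zero [simp]: "antisymmetrize n lam t 0 = 0"
  by (simp add: antisymmetrize_def)

lemma bij_column_group: "p \<in> column_group n lam t \<Longrightarrow> bij p"
  by (rule permutes_bij) (rule column_groupD)

lemma polytabloid_eq_antisymmetrize: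
  "polytabloid n lam t = antisymmetrize n lam t (tabloid_vector (tabloid lam t))"
  unfolding polytabloid_def antisymmetrize_def
  by (intro sum.cong refl) (simp add: tabloid_action_vector tabloid_comp bij_column_group)

lemma column_group_cong:
  assumes "\<And>b. b \<in> boxes lam \<Longrightarrow> s b = t b"
  shows "column_group n lam s = column_group n lam t"
proof -
  have "s ` {b \<in> boxes lam. snd b = j} = t ` {b \<in> boxes lam. snd b = j}" for j
    using assms by (intro image_cong) auto
  then show ?thesis by (simp add: column_group_def)
qed

text \<open>Tableaux are total functions with arbitrary values off the diagram, so a translate
  \<open>g \<circ> t\<close> matches a given tableau on the boxes only.\<close>

lemma polytabloid_pairing_cong:
  assumes "\<And>b. b \<in> boxes lam \<Longrightarrow> s b = t b"
  shows "polytabloid_pairing n lam s v = polytabloid_pairing n lam t v"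
proof -
  have "tabloid lam (p \<circ> s) = tabloid lam (p \<circ> t)" for p
    using assms by (intro tabloid_cong) simp
  then show ?thesis
    using column_group_cong[OF assms] by (simp add: polytabloid_pairing_def)
qed

section \<open>Translating a tableau by a permutation\<close>

lemma conj_in_column_group:
  assumes g: "g permutes {1..n}" and p: "p \<in> column_group n lam t"
  shows "g \<circ> p \<circ> inv' g \<in> column_group n lam (g \<circ> t)"
proof -
  have "(g \<circ> p \<circ> inv' g) ` (g \<circ> t) ` {b \<in> boxes lam. snd b = j} = (g \<circ> t) ` {b \<in> boxes lam. snd b = j}"
    for j
  proof -
    have "(g \<circ> p \<circ> inv' g) ` (g \<circ> t) ` {b \<in> boxes lam. snd b = j}
        = g ` p ` t ` {b \<in> boxes lam. snd b = j}"
      using permutes_inverses(2)[OF g] by (simp add: image_image)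
    also have "\<dots> = g ` t ` {b \<in> boxes lam. snd b = j}"
      unfolding column_groupD(2)[OF p] ..
    finally show ?thesis by (simp add: image_image)
  qed
  moreover have "g \<circ> p \<circ> inv' g permutes {1..n}"
    by (intro permutes_compose permutes_inv g column_groupD(1)[OF p])
  ultimately show ?thesis by (simp add: column_group_def sym_group_carrier)
qed

text \<open>The column group of \<open>g \<circ> t\<close> is the conjugate by g of that of
  \<open>t\<close>. One inclusion is \<open>conj_in_column_group\<close>; the other is the same
  inclusion for the inverse of g.\<close>

lemma sum_column_group_conj:
  fixes F :: "(nat \<Rightarrow> nat) \<Rightarrow> 'c :: comm_monoid_add"
  assumes g: "g permutes {1..n}"
  shows "(\<Sum>p\<in>column_group n lam (g \<circ> t). F p) = (\<Sum>p\<in>column_group n lam t. F (g \<circ> p \<circ> inv' g))"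
proof (rule sum.reindex_bij_witness[of _ "\<lambda>p. g \<circ> p \<circ> inv' g" "\<lambda>p. inv' g \<circ> p \<circ> g"])
  note [simp] = permutes_inverses[OF g]
  fix p
  show "g \<circ> (inv' g \<circ> p \<circ> g) \<circ> inv' g = p" "inv' g \<circ> (g \<circ> p \<circ> inv' g) \<circ> g = p"
    by (auto simp: fun_eq_iff)
  show "F (g \<circ> (inv' g \<circ> p \<circ> g) \<circ> inv' g) = F p"
    by (rule arg_cong[of _ _ F]) (auto simp: fun_eq_iff)
  show "inv' g \<circ> p \<circ> g \<in> column_group n lam t" if "p \<in> column_group n lam (g \<circ> t)"
  proof -
    have "inv' g \<circ> p \<circ> inv' (inv' g) \<in> column_group n lam (inv' g \<circ> (g \<circ> t))"
      using permutes_inv[OF g] that by (rule conj_in_column_group)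
    moreover have "inv' g \<circ> (g \<circ> t) = t" by (auto simp: fun_eq_iff)
    ultimately show ?thesis using permutes_inv_inv[OF g] by simp
  qed
qed (use conj_in_column_group[OF g] in auto)

lemma sign_conj:
  assumes "g permutes {1..n :: nat}" "p permutes {1..n}"
  shows "sign (g \<circ> p \<circ> inv' g) = sign p"
  using assms
  by (simp add: sign_comp_permutes[of _ n] permutes_compose permutes_inv sign_inv_permutes)

lemma tabloid_conj:
  assumes "g permutes {1..n}"
  shows "tabloid lam ((g \<circ> p \<circ> inv' g) \<circ> (g \<circ> t)) = map ((`) g) (tabloid lam (p \<circ> t))"
  unfolding tabloid_comp using permutes_inverses(2)[OF assms] by (simp add: image_image)

lemma tabloid_action_polytabloid:
  assumes g: "g permutes {1..n}"
  shows "tabloid_action g (polytabloid n lam t) = polytabloid n lam (g \<circ> t)"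
  unfolding polytabloid_def tabloid_action_sum tabloid_action_cscale sum_column_group_conj[OF g]
  by (intro sum.cong refl)
    (simp add: sign_conj[OF g] column_groupD tabloid_conj[OF g] tabloid_action_vector permutes_bij[OF g]
      del: o_apply)

text \<open>Invariance of the form: \<open>\<langle>v, g e\<^sub>t\<rangle> =
  \<langle>g\<^sup>-\<^sup>1 v, e\<^sub>t\<rangle>\<close>. It carries facts about the one tableau
  \<open>t\<close> over to all of its translates.\<close>

lemma polytabloid_pairing_action:
  assumes g: "g permutes {1..n}"
  shows "polytabloid_pairing n lam (g \<circ> t) v = polytabloid_pairing n lam t (tabloid_action (inv' g) v)"
  unfolding polytabloid_pairing_def sum_column_group_conj[OF g]
  by (intro sum.cong refl)
    (simp add: sign_conj[OF g] column_groupD tabloid_conj[OF g] tabloid_action_def permutes_inv_inv[OF g]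
      del: o_apply)

text \<open>Right translation by q permutes the column group and multiplies each sign by that of
  q.\<close>

lemma antisymmetrize_action:
  assumes q: "q \<in> column_group n lam t"
  shows "antisymmetrize n lam t (tabloid_action q f) = cscale (of_int (sign q)) (antisymmetrize n lam t f)"
proof -
  have "antisymmetrize n lam t (tabloid_action q f) =
      (\<Sum>p\<in>column_group n lam t. cscale (of_int (sign p)) (tabloid_action (p \<circ> q) f))"
    unfolding antisymmetrize_def
    by (intro sum.cong refl) (simp add: tabloid_action_comp bij_column_group bij_column_group[OF q])
  also have "\<dots> = (\<Sum>p\<in>column_group n lam t. cscale (of_int (sign (p \<circ> inv' q))) (tabloid_action p f))"
  proof (rule sum.reindex_bij_witness[of _ "\<lambda>p. p \<circ> inv' q" "\<lambda>p. p \<circ> q"])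
    fix p :: "nat \<Rightarrow> nat"
    note [simp] = permutes_inverses[OF column_groupD(1)[OF q]]
    show *: "p \<circ> q \<circ> inv' q = p" "p \<circ> inv' q \<circ> q = p" by (auto simp: fun_eq_iff)
    show "cscale (of_int (sign (p \<circ> q \<circ> inv' q))) (tabloid_action (p \<circ> q) f)
        = cscale (of_int (sign p)) (tabloid_action (p \<circ> q) f)"
      unfolding * ..
  qed (use q column_group_inv[OF q] in \<open>auto intro: column_group_comp\<close>)
  also have "\<dots> = cscale (of_int (sign q)) (antisymmetrize n lam t f)"
    unfolding antisymmetrize_def cfun.scale_sum_right
    by (intro sum.cong refl)
      (simp add: sign_column_group column_group_inv[OF q] sign_inv_permutes[OF column_groupD(1)[OF q]] mult.commute)
  finally show ?thesis .
qed

lemma column_group_comp_eq: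
  assumes q: "q \<in> column_group n lam t"
  shows "column_group n lam (q \<circ> t) = column_group n lam t"
proof -
  have "(q \<circ> t) ` {b \<in> boxes lam. snd b = j} = t ` {b \<in> boxes lam. snd b = j}" for j
    unfolding image_comp[symmetric] column_groupD(2)[OF q] ..
  then show ?thesis by (simp add: column_group_def)
qed

text \<open>Since \<open>q \<circ> t\<close> and \<open>t\<close> have the same column group, they
  share one antisymmetrizer, and the tabloid of \<open>q \<circ> t\<close> is q applied to that of
  \<open>t\<close>.\<close>

lemma polytabloid_column_group:
  assumes q: "q \<in> column_group n lam t"
  shows "tabloid_action q (polytabloid n lam t) = cscale (of_int (sign q)) (polytabloid n lam t)"
proof -
  have "polytabloid n lam (q \<circ> t) = antisymmetrize n lam (q \<circ> t) (tabloid_action q (tabloid_vector (tabloid lam t)))"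
    by (simp add: polytabloid_eq_antisymmetrize tabloid_action_vector tabloid_comp
        permutes_bij[OF column_groupD(1)[OF q]])
  also have "antisymmetrize n lam (q \<circ> t) = antisymmetrize n lam t"
    by (rule ext) (unfold antisymmetrize_def column_group_comp_eq[OF q], rule refl)
  finally show ?thesis
    unfolding antisymmetrize_action[OF q] polytabloid_eq_antisymmetrize[symmetric]
      tabloid_action_polytabloid[OF column_groupD(1)[OF q]] .
qed

text \<open>Only the identity of the column group returns to the tabloid of t. Scalars in front of a
  polytabloid are read off at this place throughout.\<close>

lemma polytabloid_apply_self:
  assumes t: "t \<in> tableaux n lam"
  shows "polytabloid n lam t (tabloid lam t) = 1"
proof -
  have "polytabloid n lam t (tabloid lam t) =
      (\<Sum>p\<in>column_group n lam t. if p = id then 1 else 0)"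
    unfolding polytabloid_def sum_apply
    using column_group_tabloid_eq_imp_id[OF t]
    by (intro sum.cong refl) (auto simp: tabloid_vector_def)
  then show ?thesis by simp
qed

lemma polytabloid_nonzero:
  assumes "t \<in> tableaux n lam"
  shows "polytabloid n lam t \<noteq> 0"
  using polytabloid_apply_self[OF assms] by auto

lemma transpose_same_row_tabloid:
  assumes s: "s \<in> tableaux n lam" and b: "b \<in> boxes lam" "c \<in> boxes lam" "fst b = fst c"
  shows "map ((`) (transpose (s b) (s c))) (tabloid lam s) = tabloid lam s"
proof -
  have "transpose (s b) (s c) ` s ` {a \<in> boxes lam. fst a = i} = s ` {a \<in> boxes lam. fst a = i}" for i
  proof (cases "i = fst b")
    case True
    then have "transpose (s b) (s c) permutes (s ` {b \<in> boxes lam. fst b = i})"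
      using b by (intro permutes_swap_id) auto
    then show ?thesis by (rule permutes_image)
  next
    case False
    have "transpose (s b) (s c) (s a) = s a" if "a \<in> boxes lam" "fst a = i" for a
      using that b False tableauxD[OF s]
      by (intro transpose_apply_other) (auto simp: bij_betw_def inj_on_eq_iff)
    then show ?thesis by (auto simp: image_image)
  qed
  then show ?thesis by (simp add: tabloid_def)
qed

text \<open>A dichotomy. If the entries of every column of t lie in distinct rows of s, the tabloid
  of s is a column permutation of that of t, and the result is the polytabloid up to sign. Otherwise
  two entries of a column share a row of s; their transposition fixes the tabloid and reverses the
  antisymmetrizer, so the result is zero.\<close>

lemma antisymmetrize_tabloid_vector:
  assumes ip: "integer_partition n lam" and s: "s \<in> tableaux n lam" and t: "t \<in> tableaux n lam"
  shows "\<exists>c. antisymmetrize n lam t (tabloid_vector (tabloid lam s)) = cscale c (polytabloid n lam t)"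
proof (cases "\<forall>b\<in>boxes lam. \<forall>c\<in>boxes lam. snd b = snd c \<longrightarrow>
    fst (inv_into (boxes lam) s (t b)) = fst (inv_into (boxes lam) s (t c)) \<longrightarrow> b = c")
  case True
  then obtain p where p: "p \<in> column_group n lam t" "tabloid lam (p \<circ> t) = tabloid lam s"
    by (auto intro: distinct_rows_imp_tabloid_eq[OF ip s t])
  then have "tabloid_vector (tabloid lam s) = tabloid_action p (tabloid_vector (tabloid lam t))"
    using tabloid_action_vector[OF permutes_bij[OF column_groupD(1)[OF p(1)]]]
    by (simp add: tabloid_comp)
  then show ?thesis
    using antisymmetrize_action[OF p(1)] polytabloid_eq_antisymmetrize by metis
next
  case False
  then obtain b c where bc: "b \<in> boxes lam" "c \<in> boxes lam" "snd b = snd c" "b \<noteq> c"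
    "fst (inv_into (boxes lam) s (t b)) = fst (inv_into (boxes lam) s (t c))" by blast
  note bs = tableauxD[OF s] and bt = tableauxD[OF t]
  let ?q = "transpose (t b) (t c)" and ?d = "tabloid_vector (tabloid lam s)"
  have q: "?q \<in> column_group n lam t" using t bc(1-3) by (rule transpose_in_column_group)
  have "t b \<in> s ` boxes lam" "t c \<in> s ` boxes lam"
    using bc bs bt by (auto simp: bij_betw_def)
  then have "map ((`) ?q) (tabloid lam s) = tabloid lam s"
    using transpose_same_row_tabloid[OF s, of "inv_into (boxes lam) s (t b)" "inv_into (boxes lam) s (t c)"] bc(5)
    by (simp add: inv_into_into f_inv_into_f)
  then have "tabloid_action ?q ?d = ?d"
    by (simp add: tabloid_action_vector)
  moreover have "sign ?q = -1"
    using bc bt by (auto simp: sign_swap_id bij_betw_def inj_on_eq_iff)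
  ultimately have "antisymmetrize n lam t ?d = cscale (- 1) (antisymmetrize n lam t ?d)"
    using antisymmetrize_action[OF q, of ?d] by simp
  then have "antisymmetrize n lam t ?d = cscale 0 (polytabloid n lam t)"
    by (auto simp: fun_eq_iff)
  then show ?thesis by blast
qed


section \<open>Specht modules\<close>

lemma polytabloid_in_specht:
  "t \<in> tableaux n lam \<Longrightarrow> polytabloid n lam t \<in> specht n lam"
  by (simp add: specht_def cfun.span_base)

lemma subspace_specht: "cfun.subspace (specht n lam)"
  by (simp add: specht_def)

lemma tabloid_action_specht:
  assumes g: "g permutes {1..n}" and v: "v \<in> specht n lam"
  shows "tabloid_action g v \<in> specht n lam"
proof -
  have "polytabloid n lam ` tableaux n lam \<subseteq> {v. tabloid_action g v \<in> specht n lam}"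
    using tabloid_action_polytabloid[OF g] comp_in_tableaux[OF _ g] polytabloid_in_specht by auto
  moreover have "cfun.subspace {v. tabloid_action g v \<in> specht n lam}"
    using subspace_specht
    by (auto simp: cfun.subspace_def tabloid_action_add tabloid_action_cscale)
  ultimately have "specht n lam \<subseteq> {v. tabloid_action g v \<in> specht n lam}"
    unfolding specht_def[of n lam] by (rule cfun.span_minimal)
  then show ?thesis using v by blast
qed

text \<open>The image is at most the line of the polytabloid because this already holds on each
  tabloid; the scalar on that line is then identified by evaluation.\<close>

lemma antisymmetrize_specht:
  assumes ip: "integer_partition n lam" and t: "t \<in> tableaux n lam" and v: "v \<in> specht n lam"
  shows "antisymmetrize n lam t v = cscale (polytabloid_pairing n lam t v) (polytabloid n lam t)"
proof -
  let ?L = "range (\<lambda>c. cscale c (polytabloid n lam t))"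
  have L: "cfun.subspace ?L"
    unfolding cfun.span_singleton[symmetric] by (rule cfun.subspace_span)
  \<comment> \<open>Single tabloid vectors need not lie in the Specht module, so the property is
    propagated through all functions that have it.\<close>
  let ?S = "{f. antisymmetrize n lam t f \<in> ?L}"
  have S: "cfun.subspace ?S"
    unfolding cfun.subspace_def mem_Collect_eq antisymmetrize_zero antisymmetrize_add antisymmetrize_cscale
    using cfun.subspace_0[OF L] cfun.subspace_add[OF L] cfun.subspace_scale[OF L] by blast
  have "polytabloid n lam s \<in> ?S" if s: "s \<in> tableaux n lam" for s
    unfolding polytabloid_def[of n lam s]
  proof (intro cfun.subspace_sum[OF S] cfun.subspace_scale[OF S])
    fix p assume "p \<in> column_group n lam s"
    then have "p \<circ> s \<in> tableaux n lam"
      by (intro comp_in_tableaux[OF s] column_groupD)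
    then show "tabloid_vector (tabloid lam (p \<circ> s)) \<in> ?S"
      using antisymmetrize_tabloid_vector[OF ip _ t] by blast
  qed
  then have "specht n lam \<subseteq> ?S"
    unfolding specht_def using S by (intro cfun.span_minimal) auto
  then have "antisymmetrize n lam t v \<in> ?L" using v by blast
  then obtain c where c: "antisymmetrize n lam t v = cscale c (polytabloid n lam t)" by auto
  \<comment> \<open>The polytabloid takes the value 1 here. The action brings in inverses, which the
    substitution of p by its inverse removes.\<close>
  have "c = antisymmetrize n lam t v (tabloid lam t)"
    unfolding c by (simp add: polytabloid_apply_self[OF t])
  also have "\<dots> = (\<Sum>p\<in>column_group n lam t. of_int (sign p) * v (tabloid lam (inv' p \<circ> t)))"
    unfolding antisymmetrize_def sum_apply by (simp add: tabloid_action_def tabloid_comp)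
  also have "\<dots> = polytabloid_pairing n lam t v"
    unfolding polytabloid_pairing_def
    by (rule sum.reindex_bij_witness[of _ inv' inv'])
      (auto simp: inv_inv_eq bij_column_group column_group_inv sign_inv_permutes[OF column_groupD(1)])
  finally show ?thesis using c by simp
qed

text \<open>A vector orthogonal to all polytabloids is orthogonal to their span, hence to itself if
  it lies in it.\<close>

lemma specht_eq_zero:
  assumes v: "v \<in> specht n lam"
    and orth: "\<And>s. s \<in> tableaux n lam \<Longrightarrow> polytabloid_pairing n lam s v = 0"
  shows "v = 0"
proof -
  let ?T = "tabloid lam ` tableaux n lam"
  have "?T \<subseteq> {T. set T \<subseteq> Pow {1..n} \<and> length T = length lam}"
    by (fastforce simp: tabloid_def tableaux_def bij_betw_def)
  then have fin: "finite ?T"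
    by (rule finite_subset) (intro finite_lists_length_eq, simp)
  \<comment> \<open>The ambient functions live on all lists of sets. Only because v is supported on
    genuine tabloids does the finite sum over \<open>?T\<close> see all of v.\<close>
  have supp: "v T = 0" if "T \<notin> ?T" for T
    using v unfolding specht_def
  proof (induction rule: cfun.span_induct_alt)
    case (step c x y)
    then obtain s where s: "s \<in> tableaux n lam" "x = polytabloid n lam s" by auto
    have "T \<noteq> tabloid lam (p \<circ> s)" if "p \<in> column_group n lam s" for p
      using \<open>T \<notin> ?T\<close> comp_in_tableaux[OF s(1) column_groupD(1)[OF that]] by blast
    then have "x T = 0"
      unfolding s polytabloid_def sum_apply by (intro sum.neutral) (auto simp: tabloid_vector_def)
    then show ?case using step by simp
  qed simp
  \<comment> \<open>The Hermitian form agrees with the pairing when u is a polytabloid; conjugation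
    is there so that u = v gives a sum of squared moduli.\<close>
  have "(\<Sum>T\<in>?T. v T * cnj (u T)) = 0" if "u \<in> specht n lam" for u
    using that unfolding specht_def
  proof (induction rule: cfun.span_induct_alt)
    case (step c x y)
    then obtain s where s: "s \<in> tableaux n lam" "x = polytabloid n lam s" by auto
    have "(\<Sum>T\<in>?T. v T * cnj (x T)) =
        (\<Sum>T\<in>?T. \<Sum>p\<in>column_group n lam s. of_int (sign p) * (if T = tabloid lam (p \<circ> s) then v T else 0))"
      unfolding s polytabloid_def sum_apply
      by (intro sum.cong refl)
        (auto simp: tabloid_vector_def sum_distrib_left cnj_sum intro!: sum.cong)
    also have "\<dots> = (\<Sum>p\<in>column_group n lam s. \<Sum>T\<in>?T. of_int (sign p) * (if T = tabloid lam (p \<circ> s) then v T else 0))"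
      by (rule sum.swap)
    also have "\<dots> = polytabloid_pairing n lam s v"
      unfolding polytabloid_pairing_def
    proof (intro sum.cong refl)
      fix p assume "p \<in> column_group n lam s"
      then have "tabloid lam (p \<circ> s) \<in> ?T"
        using comp_in_tableaux[OF s(1) column_groupD(1)] by blast
      then show "(\<Sum>T\<in>?T. of_int (sign p) * (if T = tabloid lam (p \<circ> s) then v T else 0))
          = of_int (sign p) * v (tabloid lam (p \<circ> s))"
        using fin by (simp flip: sum_distrib_left)
    qed
    finally have "(\<Sum>T\<in>?T. v T * cnj (x T)) = 0" using orth[OF s(1)] by simp
    moreover have "(\<Sum>T\<in>?T. v T * cnj ((cscale c x + y) T)) =
        cnj c * (\<Sum>T\<in>?T. v T * cnj (x T)) + (\<Sum>T\<in>?T. v T * cnj (y T))"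
      by (simp add: sum.distrib sum_distrib_left algebra_simps)
    ultimately show ?case using step by simp
  qed simp
  from this[OF v] have "complex_of_real (\<Sum>T\<in>?T. (cmod (v T))\<^sup>2) = 0"
    by (simp add: complex_norm_square del: of_real_power)
  then have "(\<Sum>T\<in>?T. (cmod (v T))\<^sup>2) = 0" by (simp only: of_real_eq_0_iff)
  then have "v T = 0" if "T \<in> ?T" for T
    using fin that by (subst (asm) sum_nonneg_eq_0_iff) auto
  then show ?thesis using supp by (metis ext zero_fun_apply)
qed


section \<open>The character of the stabilizer\<close>

text \<open>On a union of disjoint invariant blocks q is the composite of its restrictions, each
  extended by the identity; \<open>sign_on\<close> is the sign of such an extension.\<close>

lemma sign_eq_prod_sign_on_blocks:
  assumes "finite P" "disjoint P" "\<And>B. B \<in> P \<Longrightarrow> finite B"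
    and "\<And>B. B \<in> P \<Longrightarrow> q ` B = B" "inj_on q (\<Union>P)"
  shows "sign_on (\<Union>P) q = (\<Prod>B\<in>P. sign_on B q)"
  using assms
proof (induction P rule: finite_induct)
  case empty
  show ?case by (simp add: sign_on_def restrict_id_def)
next
  case (insert B P)
  have disj: "B \<inter> \<Union>P = {}"
    using insert.prems(1) insert.hyps(2) by (auto simp: pairwise_insert disjnt_def)
  have "q ` \<Union>P = \<Union>P"
    unfolding image_Union using insert.prems(3) by simp
  then have bij: "bij_betw q B B" "bij_betw q (\<Union>P) (\<Union>P)"
    using insert.prems(3,4) by (auto simp: bij_betw_def inj_on_def)
  have "restrict_id q (\<Union>(insert B P)) = restrict_id q B \<circ> restrict_id q (\<Union>P)"
    using disj bij_betwE[OF bij(2)] by (auto simp: restrict_id_def fun_eq_iff)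
  moreover have "finite (\<Union>P)"
    using insert by auto
  ultimately have "sign_on (\<Union>(insert B P)) q = sign_on B q * sign_on (\<Union>P) q"
    unfolding sign_on_def using insert.prems(2) bij
    by (simp, subst sign_compose)
      (auto intro!: permutes_imp_permutation[OF _ permutes_restrict_id])
  moreover have "sign_on (\<Union>P) q = (\<Prod>B\<in>P. sign_on B q)"
    using insert.prems by (intro insert.IH) (auto simp: pairwise_insert intro: inj_on_subset)
  ultimately show ?case using insert.hyps by simp
qed

text \<open>Serves to list the blocks of a set partition in the order of the parts of
  \<open>conjugate lam\<close>, so that block number j can fill column number j.\<close>

lemma ex_list_of_image_mset:
  "image_mset f M = mset ys \<Longrightarrow> \<exists>xs. mset xs = M \<and> map f xs = ys"
proof (induction ys arbitrary: M)
  case (Cons y ys)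
  then have "image_mset f M = add_mset y (mset ys)" by simp
  from msed_map_invR[OF this]
  obtain x N where "M = add_mset x N" "f x = y" "image_mset f N = mset ys" by blast
  moreover from Cons.IH[OF this(3)] obtain xs where "mset xs = N" "map f xs = ys" by blast
  ultimately have "mset (x # xs) = M \<and> map f (x # xs) = y # ys" by simp
  then show ?case by (rule exI)
qed simp

text \<open>The list \<open>Bs\<close> matches the blocks with the columns of the diagram. Among
  blocks of equal size the order is an arbitrary choice.\<close>

locale labelled_partition =
  fixes n :: nat and lam :: "nat list" and \<alpha> :: "nat set set"
    and \<iota> :: "nat set \<Rightarrow> nat \<Rightarrow> nat" and Bs :: "nat set list"
  assumes ip: "integer_partition n lam"
    and Bs: "distinct Bs" "set Bs = \<alpha>" "map card Bs = conjugate lam"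
    and part: "partition_on {1..n} \<alpha>"
    and lab: "block_labelling \<alpha> \<iota>"
begin

abbreviation "G \<equiv> sym_group n"
abbreviation "W \<equiv> stabilizer n \<alpha>"
abbreviation "\<chi> \<equiv> wreath_character \<alpha> \<iota>"

text \<open>Column j is filled with block number j, and the label of an entry is its row. The
  labelling that identifies blocks of equal size thus also cuts out the rows.\<close>

definition t :: "nat \<times> nat \<Rightarrow> nat" where "t = (\<lambda>(i, j). \<iota> (Bs ! j) i)"

lemma block_subset: "B \<in> \<alpha> \<Longrightarrow> B \<subseteq> {1..n}"
  using part by (auto simp: partition_on_def)

lemma finite_block: "B \<in> \<alpha> \<Longrightarrow> finite B"
  using block_subset finite_subset by blast

lemma finite_blocks: "finite \<alpha>"
  using Bs(2) by auto

lemma blocks_disjoint: "disjoint \<alpha>"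
  using part by (simp add: partition_on_def)

lemma Union_blocks: "\<Union>\<alpha> = {1..n}"
  using part by (simp add: partition_on_def)

lemma block_eqI: "\<lbrakk>B \<in> \<alpha>; C \<in> \<alpha>; x \<in> B; x \<in> C\<rbrakk> \<Longrightarrow> B = C"
  using blocks_disjoint by (auto simp: disjoint_def)

lemma label_bij: "B \<in> \<alpha> \<Longrightarrow> bij_betw (\<iota> B) {..<card B} B"
  using lab by (simp add: block_labelling_def)

lemma boxes_eq: "boxes lam = {(i, j). j < length Bs \<and> i < card (Bs ! j)}"
  unfolding boxes_conjugate[OF ip] Bs(3)[symmetric] by auto

lemma t_column: "j < length Bs \<Longrightarrow> t ` {b \<in> boxes lam. snd b = j} = Bs ! j"
proof -
  assume j: "j < length Bs"
  have "{b \<in> boxes lam. snd b = j} = (\<lambda>i. (i, j)) ` {..<card (Bs ! j)}"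
    using j by (auto simp: boxes_eq)
  then have "t ` {b \<in> boxes lam. snd b = j} = \<iota> (Bs ! j) ` {..<card (Bs ! j)}"
    by (simp add: image_image t_def)
  then show ?thesis
    using bij_betw_imp_surj_on[OF label_bij[of "Bs ! j"]] j Bs(2) nth_mem[OF j] by simp
qed

lemma t_column_empty: "\<not> j < length Bs \<Longrightarrow> {b \<in> boxes lam. snd b = j} = {}"
  by (auto simp: boxes_eq)

lemma ball_blocks_iff: "(\<forall>B\<in>\<alpha>. P B) \<longleftrightarrow> (\<forall>j<length Bs. P (Bs ! j))"
  unfolding Bs(2)[symmetric] by (simp add: all_set_conv_all_nth)

lemma t_tableau: "t \<in> tableaux n lam"
proof -
  have "inj_on t (boxes lam)"
  proof (rule inj_onI)
    fix b c assume b: "b \<in> boxes lam" and c: "c \<in> boxes lam" and eq: "t b = t c"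
    obtain i j i' j' where [simp]: "b = (i, j)" "c = (i', j')" by (cases b, cases c)
    have j: "j < length Bs" "j' < length Bs" "i < card (Bs ! j)" "i' < card (Bs ! j')"
      using b c by (auto simp: boxes_eq)
    then have B: "Bs ! j \<in> \<alpha>" "Bs ! j' \<in> \<alpha>" using Bs(2) by auto
    have "t b \<in> Bs ! j" "t c \<in> Bs ! j'"
      using t_column[OF j(1)] t_column[OF j(2)] b c by auto
    then have "Bs ! j = Bs ! j'" using eq block_eqI[OF B] by simp
    then have "j = j'" using Bs(1) j by (simp add: nth_eq_iff_index_eq)
    moreover have "i = i'"
      using eq j \<open>j = j'\<close> bij_betw_imp_inj_on[OF label_bij[OF B(1)]]
      by (auto simp: t_def inj_on_def)
    ultimately show "b = c" by simp
  qed
  moreover have "t ` boxes lam = {1..n}"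
  proof -
    have "boxes lam = (\<Union>j<length Bs. {b \<in> boxes lam. snd b = j})"
      by (auto simp: boxes_eq)
    then have "t ` boxes lam = (\<Union>j<length Bs. t ` {b \<in> boxes lam. snd b = j})" by blast
    also have "\<dots> = (\<Union>j<length Bs. Bs ! j)" by (simp add: t_column)
    also have "\<dots> = \<Union>\<alpha>" unfolding Bs(2)[symmetric] set_conv_nth by blast
    finally show ?thesis using Union_blocks by simp
  qed
  ultimately show ?thesis by (simp add: tableaux_def bij_betw_def)
qed

text \<open>A general w covers two uses: elements of the stabilizer, which only permute the blocks,
  and arbitrary permutations, for which the Young subgroup of the translated partition must be
  recognised.\<close>

lemma column_group_comp_t:
  "column_group n lam (w \<circ> t) = {p \<in> carrier G. \<forall>B\<in>\<alpha>. p ` w ` B = w ` B}"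
proof -
  have "(\<forall>j. p ` (w \<circ> t) ` {b \<in> boxes lam. snd b = j} = (w \<circ> t) ` {b \<in> boxes lam. snd b = j}) \<longleftrightarrow>
      (\<forall>j<length Bs. p ` w ` Bs ! j = w ` Bs ! j)" for p
  proof -
    have "p ` (w \<circ> t) ` {b \<in> boxes lam. snd b = j} = (w \<circ> t) ` {b \<in> boxes lam. snd b = j} \<longleftrightarrow>
        (j < length Bs \<longrightarrow> p ` w ` Bs ! j = w ` Bs ! j)" for j
    proof (cases "j < length Bs")
      case True
      then show ?thesis
        unfolding image_comp[symmetric, of w t] t_column[OF True] by iprover
    next
      case False
      then show ?thesis unfolding t_column_empty[OF False] by simp
    qed
    then show ?thesis by (rule iff_allI)
  qed
  then show ?thesis
    unfolding column_group_def ball_blocks_iff by simp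
qed

lemma column_group_t: "column_group n lam t = young_subgroup n \<alpha>"
  using column_group_comp_t[of id] by (simp add: young_subgroup_def)

lemma column_group_stabilizer:
  assumes "w \<in> W"
  shows "column_group n lam (w \<circ> t) = young_subgroup n \<alpha>"
proof -
  have "(\<forall>B\<in>\<alpha>. p ` w ` B = w ` B) \<longleftrightarrow> (\<forall>B\<in>(`) w ` \<alpha>. p ` B = B)" for p
    unfolding ball_simps ..
  moreover have "(`) w ` \<alpha> = \<alpha>" using assms by (simp add: stabilizer_def)
  ultimately show ?thesis by (simp only: column_group_comp_t young_subgroup_def)
qed

text \<open>The rows are expressed by blocks and labels, without the order \<open>Bs\<close>, so
  that the blocks can be permuted inside this description.\<close>

lemma tabloid_comp_t:
  "tabloid lam (f \<circ> t) = map (\<lambda>i. {f (\<iota> B i) | B. B \<in> \<alpha> \<and> i < card B}) [0..<length lam]"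
proof -
  have "(f \<circ> t) ` {b \<in> boxes lam. fst b = i} = {f (\<iota> B i) | B. B \<in> \<alpha> \<and> i < card B}" for i
  proof (intro Set.set_eqI iffI)
    fix x assume "x \<in> {f (\<iota> B i) | B. B \<in> \<alpha> \<and> i < card B}"
    then obtain j where "j < length Bs" "i < card (Bs ! j)" "x = f (\<iota> (Bs ! j) i)"
      unfolding Bs(2)[symmetric] in_set_conv_nth by blast
    then show "x \<in> (f \<circ> t) ` {b \<in> boxes lam. fst b = i}"
      by (intro image_eqI[of _ _ "(i, j)"]) (auto simp: boxes_eq t_def)
  qed (use Bs(2) in \<open>force simp: boxes_eq t_def\<close>)
  then show ?thesis by (simp add: tabloid_def)
qed

text \<open>
  Composing \<open>w\<close> with the label-preserving permutation of the blocks that undoes its action on \<open>\<alpha>\<close>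
  gives an element \<open>q\<close> of the column group; the second factor does not move rows.
\<close>

lemma polytabloid_stabilizer:
  assumes w: "w \<in> W"
  shows "polytabloid n lam (w \<circ> t) = cscale (\<chi> w) (polytabloid n lam t)"
proof -
  have wp: "w permutes {1..n}" and w\<alpha>: "(`) w ` \<alpha> = \<alpha>"
    using w by (auto simp: stabilizer_def sym_group_carrier)
  have inj: "inj w" by (rule permutes_inj[OF wp])
  have wB: "w ` B \<in> \<alpha>" if "B \<in> \<alpha>" for B using that w\<alpha> by blast
  have card_wB: "card (w ` B) = card B" for B
    using inj by (intro card_image) (auto intro: inj_on_subset)
  define blk where "blk x = (THE B. B \<in> \<alpha> \<and> x \<in> B)" for x
  have blk: "blk x = B" if "B \<in> \<alpha>" "x \<in> B" for x B
    unfolding blk_def using that block_eqI by (intro the_equality) auto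
  \<comment> \<open>An entry x is traced back to the entry with the same label in the block that w
    carries onto the block of x, and then w is applied. Thus each block is mapped to itself.\<close>
  define q0 where
    "q0 x = w (\<iota> (inv' w ` blk x) (the_inv_into {..<card (blk x)} (\<iota> (blk x)) x))" for x
  have label: "\<iota> B i \<in> B" if "B \<in> \<alpha>" "i < card B" for B i
    using label_bij[OF that(1)] that(2) by (auto dest: bij_betwE)
  have q0: "q0 (\<iota> (w ` B) i) = w (\<iota> B i)" if "B \<in> \<alpha>" "i < card B" for B i
  proof -
    have i: "i < card (w ` B)" using that card_wB by simp
    have "blk (\<iota> (w ` B) i) = w ` B"
      using wB[OF that(1)] label[OF _ i] by (intro blk) auto
    moreover have "the_inv_into {..<card (w ` B)} (\<iota> (w ` B)) (\<iota> (w ` B) i) = i"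
      using i label_bij[OF wB[OF that(1)]] by (intro the_inv_into_f_f) (auto simp: bij_betw_def)
    moreover have "inv' w ` w ` B = B" using inj by (rule image_inv_f_f)
    ultimately show ?thesis by (simp add: q0_def)
  qed
  have q0_image: "q0 ` w ` B = w ` B" if "B \<in> \<alpha>" for B
  proof -
    have "w ` B = \<iota> (w ` B) ` {..<card B}"
      using label_bij[OF wB[OF that]] card_wB by (simp add: bij_betw_def)
    then have "q0 ` w ` B = q0 ` \<iota> (w ` B) ` {..<card B}" by (rule arg_cong)
    also have "\<dots> = w ` \<iota> B ` {..<card B}"
      using q0[OF that] by (auto simp: image_image)
    also have "\<iota> B ` {..<card B} = B" using label_bij[OF that] by (simp add: bij_betw_def)
    finally show ?thesis .
  qed
  have q0_block: "q0 ` B = B" if "B \<in> \<alpha>" for B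
  proof -
    from that w\<alpha> obtain C where C: "C \<in> \<alpha>" "B = w ` C" by blast
    show ?thesis unfolding C(2) by (rule q0_image[OF C(1)])
  qed
  have "q0 ` {1..n} = {1..n}"
    unfolding Union_blocks[symmetric] image_Union using q0_block by auto
  then have bij0: "bij_betw q0 {1..n} {1..n}"
    by (simp add: bij_betw_def eq_card_imp_inj_on)
  define q where "q = restrict_id q0 {1..n}"
  have qp: "q permutes {1..n}" unfolding q_def by (rule permutes_restrict_id[OF bij0])
  have q_q0: "q x = q0 x" if "x \<in> B" "B \<in> \<alpha>" for x B
    using that(1) block_subset[OF that(2)] by (auto simp: q_def)
  then have q_block: "q ` B = B" if "B \<in> \<alpha>" for B
    using that q0_block[OF that] by (simp cong: image_cong)
  have q: "q \<in> column_group n lam t"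
    unfolding column_group_t young_subgroup_def using qp q_block by (simp add: sym_group_carrier)
  have q_label: "q (\<iota> (w ` B) i) = w (\<iota> B i)" if "B \<in> \<alpha>" "i < card B" for B i
    using q0[OF that] q_q0[OF label[OF wB] wB, OF that(1) _ that(1)] card_wB[of B] that(2) by simp
  \<comment> \<open>As w permutes the blocks and keeps their sizes, B may be replaced by its image
    under w; the defining property of q then matches the two rows element by element.\<close>
  have "{w (\<iota> B i) | B. B \<in> \<alpha> \<and> i < card B} = {q (\<iota> B i) | B. B \<in> \<alpha> \<and> i < card B}" for i
  proof -
    have "{q (\<iota> B i) | B. B \<in> \<alpha> \<and> i < card B} = {q (\<iota> B i) | B. B \<in> (`) w ` \<alpha> \<and> i < card B}"
      unfolding w\<alpha> ..
    also have "\<dots> = {q (\<iota> (w ` B) i) | B. B \<in> \<alpha> \<and> i < card B}"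
      by (auto simp: card_wB)
    also have "\<dots> = {w (\<iota> B i) | B. B \<in> \<alpha> \<and> i < card B}"
      by (intro Collect_cong ex_cong1) (auto simp: q_label)
    finally show ?thesis by simp
  qed
  then have tab: "tabloid lam (w \<circ> t) = tabloid lam (q \<circ> t)"
    by (simp add: tabloid_comp_t)
  have "polytabloid n lam (w \<circ> t) = polytabloid n lam (q \<circ> t)"
    unfolding polytabloid_def column_group_stabilizer[OF w] column_group_comp_eq[OF q] column_group_t
      tabloid_comp[of lam _ "_ \<circ> t"] tab ..
  also have "\<dots> = cscale (of_int (sign q)) (polytabloid n lam t)"
    by (simp only: polytabloid_column_group[OF q] tabloid_action_polytabloid[OF qp, symmetric])
  also have "sign q = (\<Prod>B\<in>\<alpha>. sign (block_component \<iota> w B))"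
  proof -
    have "sign q = sign_on (\<Union>\<alpha>) q"
      using qp by (simp add: sign_on_permutes Union_blocks)
    also have "\<dots> = (\<Prod>B\<in>\<alpha>. sign_on B q)"
      using finite_blocks blocks_disjoint finite_block q_block permutes_inj[OF qp]
      by (intro sign_eq_prod_sign_on_blocks) (auto intro: inj_on_subset)
    \<comment> \<open>The component of w at B describes q on the image of B, not on B itself; hence
      the reindexing by w before the factors are compared.\<close>
    also have "\<dots> = (\<Prod>B\<in>\<alpha>. sign_on (w ` B) q)"
      using inj w\<alpha>
      by (intro prod.reindex_bij_betw[symmetric, of "(`) w"])
        (auto simp: bij_betw_def inj_on_def inj_image_eq_iff)
    also have "\<dots> = (\<Prod>B\<in>\<alpha>. sign (block_component \<iota> w B))"
    proof (intro prod.cong refl)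
      fix B assume B: "B \<in> \<alpha>"
      define c where "c = block_component \<iota> w B"
      note bB = label_bij[OF B] and bwB = label_bij[OF wB[OF B]]
      have c: "c i = the_inv_into {..<card B} (\<iota> (w ` B)) (w (\<iota> B i))" if "i < card B" for i
        using that by (simp add: c_def block_component_def)
      have bij_comp: "bij_betw (the_inv_into {..<card B} (\<iota> (w ` B)) \<circ> (w \<circ> \<iota> B)) {..<card B} {..<card B}"
        using bB bwB card_wB[of B] inj
        by (intro bij_betw_trans[of _ _ "w ` B"] bij_betw_trans[of _ _ B] bij_betw_the_inv_into)
          (auto simp: bij_betw_def intro: inj_on_subset)
      have "c = restrict_id (the_inv_into {..<card B} (\<iota> (w ` B)) \<circ> (w \<circ> \<iota> B)) {..<card B}"
        by (auto simp: c_def block_component_def restrict_id_def)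
      then have cp: "c permutes {..<card B}"
        using permutes_restrict_id[OF bij_comp] by simp
      \<comment> \<open>Transported by the labels of the image block, c sends the entry with label i
        to the image under w of the entry of B with label i, exactly as q does.\<close>
      have "restrict_id q (w ` B) = map_permutation {..<card B} (\<iota> (w ` B)) c"
      proof
        fix x
        show "restrict_id q (w ` B) x = map_permutation {..<card B} (\<iota> (w ` B)) c x"
        proof (cases "x \<in> w ` B")
          case True
          then obtain i where i: "i < card B" "x = \<iota> (w ` B) i"
            using bwB card_wB[of B] by (auto simp: bij_betw_def)
          have "map_permutation {..<card B} (\<iota> (w ` B)) c x = \<iota> (w ` B) (c i)"
            unfolding i(2) using i(1) bwB card_wB[of B]
            by (intro map_permutation_apply) (auto simp: bij_betw_def)
          also have "\<dots> = w (\<iota> B i)"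
            unfolding c[OF i(1)] using bwB card_wB[of B] label[OF B i(1)]
            by (intro f_the_inv_into_f) (auto simp: bij_betw_def)
          finally show ?thesis using True q_label[OF B i(1)] i(2) by simp
        next
          case False
          then have "x \<notin> \<iota> (w ` B) ` {..<card B}"
            using bwB card_wB[of B] by (simp add: bij_betw_def)
          then show ?thesis using False by (simp add: map_permutation_def)
        qed
      qed
      then show "sign_on (w ` B) q = sign c"
        unfolding sign_on_def using cp bwB card_wB[of B]
        by (simp add: sign_map_permutation bij_betw_def)
    qed
    finally show ?thesis .
  qed
  also have "of_int \<dots> = \<chi> w" by (simp add: wreath_character_def)
  finally show ?thesis .
qed

end


section \<open>Intertwining operators\<close>

lemma intertwinersD:
  assumes "f \<in> intertwiners G V \<rho> W \<sigma>"
  shows "v \<in> V \<Longrightarrow> f v \<in> W"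
    and "u \<in> V \<Longrightarrow> v \<in> V \<Longrightarrow> f (u + v) = f u + f v"
    and "v \<in> V \<Longrightarrow> f (cscale c v) = cscale c (f v)"
    and "g \<in> carrier G \<Longrightarrow> v \<in> V \<Longrightarrow> f (\<rho> g v) = \<sigma> g (f v)"
    and "v \<notin> V \<Longrightarrow> f v = 0"
  using assms by (simp_all add: intertwiners_def)

lemma intertwiner_zero:
  assumes "f \<in> intertwiners G V \<rho> W \<sigma>" "cfun.subspace V"
  shows "f 0 = 0"
  using intertwinersD(3)[OF assms(1) cfun.subspace_0[OF assms(2)], of 0]
  by simp

lemma intertwiner_sum:
  assumes f: "f \<in> intertwiners G V \<rho> W \<sigma>" and V: "cfun.subspace V"
    and x: "\<And>a. a \<in> A \<Longrightarrow> x a \<in> V"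
  shows "f (\<Sum>a\<in>A. x a) = (\<Sum>a\<in>A. f (x a))"
  using x
proof (induct A rule: infinite_finite_induct)
  case (insert a A)
  have "(\<Sum>a\<in>A. x a) \<in> V" using insert.prems by (intro cfun.subspace_sum[OF V]) blast
  moreover have "x a \<in> V" "f (\<Sum>a\<in>A. x a) = (\<Sum>a\<in>A. f (x a))"
    using insert.prems insert.hyps(3) by blast+
  ultimately show ?case
    unfolding sum.insert[OF insert.hyps(1,2)] by (simp only: intertwinersD(2)[OF f])
qed (simp_all only: sum.infinite sum.empty intertwiner_zero[OF f V] simp_thms)

text \<open>The isomorphism in \<open>is_pi_subspace\<close> leads out of the unknown subspace,
  whereas Frobenius reciprocity controls maps out of the Specht module.\<close>

lemma inverse_intertwiner:
  assumes f: "f \<in> intertwiners G V \<rho> W \<sigma>" and V: "subrepresentation G M \<rho> V"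
    and bij: "bij_betw f V W"
  shows "(\<lambda>w. if w \<in> W then inv_into V f w else 0) \<in> intertwiners G W \<sigma> V \<rho>" (is "?h \<in> _")
proof -
  have sV: "cfun.subspace V" and rV: "\<And>g v. g \<in> carrier G \<Longrightarrow> v \<in> V \<Longrightarrow> \<rho> g v \<in> V"
    using V by (auto simp: subrepresentation_def)
  have W: "W = f ` V" using bij by (simp add: bij_betw_def)
  have h: "?h (f v) = v" if "v \<in> V" for v
    using that bij_betw_inv_into_left[OF bij] W by simp
  have hV: "?h w \<in> V" if "w \<in> W" for w
    using that h unfolding W by auto
  have add: "?h (u + v) = ?h u + ?h v" if "u \<in> W" "v \<in> W" for u v
  proof -
    from that obtain u' v' where uv: "u' \<in> V" "u = f u'" "v' \<in> V" "v = f v'" unfolding W by blast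
    then have "u + v = f (u' + v')" by (simp only: intertwinersD(2)[OF f])
    then show ?thesis
      by (simp only: uv(2,4) h[OF uv(1)] h[OF uv(3)] h[OF cfun.subspace_add[OF sV uv(1,3)]])
  qed
  have scale: "?h (cscale c v) = cscale c (?h v)" if "v \<in> W" for c v
  proof -
    from that obtain v' where v: "v' \<in> V" "v = f v'" unfolding W by blast
    then have "cscale c v = f (cscale c v')" by (simp only: intertwinersD(3)[OF f])
    then show ?thesis
      by (simp only: v(2) h[OF v(1)] h[OF cfun.subspace_scale[OF sV v(1)]])
  qed
  have equiv: "?h (\<sigma> g v) = \<rho> g (?h v)" if "g \<in> carrier G" "v \<in> W" for g v
  proof -
    from that obtain v' where v: "v' \<in> V" "v = f v'" unfolding W by blast
    then have "\<sigma> g v = f (\<rho> g v')" by (simp only: intertwinersD(4)[OF f that(1)])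
    then show ?thesis
      by (simp only: v(2) h[OF v(1)] h[OF rV[OF that(1) v(1)]])
  qed
  show ?thesis
    unfolding intertwiners_def mem_Collect_eq
    using hV add scale equiv by (intro conjI ballI allI impI) (simp_all only: if_False)
qed


section \<open>Actions on function spaces over the symmetric group\<close>

lemma xi_action_add: "xi_action n p (f + g) = xi_action n p f + xi_action n p g"
  by (auto simp: induced_action_def fun_eq_iff)

lemma xi_action_cscale: "xi_action n p (cscale c f) = cscale c (xi_action n p f)"
  by (auto simp: induced_action_def fun_eq_iff)

lemma xi_action_apply:
  assumes "p permutes {1..n}" "g permutes {1..n}"
  shows "xi_action n p f g = f (inv' p \<circ> g)"
  using assms by (simp add: induced_action_def sym_group_carrier sym_group_mult)

lemma xi_action_comp:
  assumes p: "p permutes {1..n}" and q: "q permutes {1..n}"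
  shows "xi_action n (p \<circ> q) f = xi_action n p (xi_action n q f)"
proof
  fix g
  show "xi_action n (p \<circ> q) f g = xi_action n p (xi_action n q f) g"
  proof (cases "g permutes {1..n}")
    case True
    then show ?thesis
      using p q by (simp add: xi_action_apply permutes_compose permutes_inv
          o_inv_distrib permutes_bij o_assoc)
  next
    case False
    then show ?thesis by (simp add: induced_action_def sym_group_carrier)
  qed
qed

lemma xi_action_id:
  assumes "\<And>g. \<not> g permutes {1..n} \<Longrightarrow> f g = 0"
  shows "xi_action n id f = f"
  using assms
  by (auto simp: induced_action_def sym_group_carrier sym_group_mult permutes_id fun_eq_iff)


lemma eq_cscale_minus_one_imp_zero:
  assumes "f = cscale (- 1) f"
  shows "f = 0"
proof
  fix x
  have "f x = - f x" using fun_cong[OF assms, of x] by simp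
  then show "f x = 0 x" by simp
qed


section \<open>Sums of fixed spaces of transpositions\<close>

lemma transpositionsD:
  assumes "\<tau> \<in> transpositions n"
  shows "\<tau> permutes {1..n}" "\<tau> \<circ> \<tau> = id" "inv' \<tau> = \<tau>" "sign \<tau> = -1"
  using assms by (auto simp: transpositions_def sign_swap_id intro: permutes_swap_id)

lemma young_subgroup_comp:
  assumes "p \<in> young_subgroup n \<beta>" "q \<in> young_subgroup n \<beta>"
  shows "p \<circ> q \<in> young_subgroup n \<beta>"
  using assms by (auto simp: young_subgroup_def sym_group_carrier permutes_compose simp flip: image_image)

lemma finite_young_subgroup [simp]: "finite (young_subgroup n \<beta>)"
  by (rule finite_subset[OF _ finite_permutations[of "{1..n}"]])
    (auto simp: young_subgroup_def sym_group_carrier)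

lemma id_in_young_subgroup [simp]: "id \<in> young_subgroup n \<beta>"
  by (simp add: young_subgroup_def sym_group_carrier permutes_id)

text \<open>
  Modulo the sum \<open>U\<close> of the fixed spaces, every transposition in \<open>T\<close> acts as \<open>-1\<close>, so that the
  group generated by \<open>T\<close> acts through the sign and the antisymmetrizer as multiplication by the
  group order.
\<close>

lemma fixed_sum_eq_kernel:
  assumes V: "cfun.subspace V" "\<And>p v. p permutes {1..n} \<Longrightarrow> v \<in> V \<Longrightarrow> xi_action n p v \<in> V"
    and supp: "\<And>v g. v \<in> V \<Longrightarrow> \<not> g permutes {1..n} \<Longrightarrow> v g = 0"
    and T: "T \<subseteq> transpositions n" "generate (sym_group n) T = young_subgroup n \<beta>"
  shows "fixed_sum V (xi_action n) T =
    {v \<in> V. (\<Sum>p\<in>young_subgroup n \<beta>. cscale (of_int (sign p)) (xi_action n p v)) = 0}"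
    (is "_ = {v \<in> V. ?\<kappa> v = 0}")
proof (rule subset_antisym)
  have \<kappa>_add: "?\<kappa> (u + v) = ?\<kappa> u + ?\<kappa> v" for u v
    by (simp add: xi_action_add cfun.scale_right_distrib sum.distrib)
  have \<kappa>_scale: "?\<kappa> (cscale c v) = cscale c (?\<kappa> v)" for c v
    by (simp add: xi_action_cscale cfun.scale_sum_right mult.commute)
  have "cfun.subspace {v \<in> V. ?\<kappa> v = 0}"
  proof (rule cfun.subspaceI)
    show "0 \<in> {v \<in> V. ?\<kappa> v = 0}"
      using cfun.subspace_0[OF V(1)] \<kappa>_scale[of 0 0] by simp
  next
    fix u v assume "u \<in> {v \<in> V. ?\<kappa> v = 0}" "v \<in> {v \<in> V. ?\<kappa> v = 0}"
    then show "u + v \<in> {v \<in> V. ?\<kappa> v = 0}"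
      using \<kappa>_add[of u v] cfun.subspace_add[OF V(1), of u v] by simp
  next
    fix c v assume "v \<in> {v \<in> V. ?\<kappa> v = 0}"
    then show "cscale c v \<in> {v \<in> V. ?\<kappa> v = 0}"
      using \<kappa>_scale[of c v] cfun.subspace_scale[OF V(1), of v c] by simp
  qed
  moreover have "?\<kappa> v = 0" if "\<tau> \<in> T" "v \<in> V" and fixed: "xi_action n \<tau> v = v" for \<tau> v
  proof -
    note \<tau> = transpositionsD[of \<tau> n]
    have \<tau>T: "\<tau> \<in> transpositions n" using that T by blast
    have \<tau>Y: "\<tau> \<in> young_subgroup n \<beta>" unfolding T(2)[symmetric] by (rule generate.incl) fact
    \<comment> \<open>Translation by \<tau> changes every sign and, since v is fixed by \<tau>,
      nothing else; so the sum equals its own negative.\<close>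
    have "?\<kappa> v = (\<Sum>p\<in>young_subgroup n \<beta>. cscale (of_int (sign (p \<circ> \<tau>))) (xi_action n (p \<circ> \<tau>) v))"
    proof (rule sum.reindex_bij_witness[of _ "\<lambda>p. p \<circ> \<tau>" "\<lambda>p. p \<circ> \<tau>"])
      fix p :: "nat \<Rightarrow> nat"
      show eq: "p \<circ> \<tau> \<circ> \<tau> = p"
        unfolding o_assoc[symmetric] \<tau>(2)[OF \<tau>T] by simp
      show "p \<circ> \<tau> \<circ> \<tau> = p" by (rule eq)
      assume "p \<in> young_subgroup n \<beta>"
      then show "p \<circ> \<tau> \<in> young_subgroup n \<beta>" using \<tau>Y by (rule young_subgroup_comp)
      then show "p \<circ> \<tau> \<in> young_subgroup n \<beta>" .
      show "cscale (of_int (sign (p \<circ> \<tau> \<circ> \<tau>))) (xi_action n (p \<circ> \<tau> \<circ> \<tau>) v)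
          = cscale (of_int (sign p)) (xi_action n p v)"
        unfolding eq ..
    qed
    also have "\<dots> = (\<Sum>p\<in>young_subgroup n \<beta>. cscale (- 1) (cscale (of_int (sign p)) (xi_action n p v)))"
    proof (rule sum.cong[OF refl])
      fix p assume "p \<in> young_subgroup n \<beta>"
      then have p: "p permutes {1..n}" by (simp add: young_subgroup_def sym_group_carrier)
      show "cscale (of_int (sign (p \<circ> \<tau>))) (xi_action n (p \<circ> \<tau>) v)
          = cscale (- 1) (cscale (of_int (sign p)) (xi_action n p v))"
        by (simp add: sign_comp_permutes[OF p \<tau>(1)[OF \<tau>T]] \<tau>(4)[OF \<tau>T] xi_action_comp[OF p \<tau>(1)[OF \<tau>T]] fixed)
    qed
    also have "\<dots> = cscale (- 1) (?\<kappa> v)" by (rule cfun.scale_sum_right[symmetric])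
    finally show ?thesis by (rule eq_cscale_minus_one_imp_zero)
  qed
  ultimately show "fixed_sum V (xi_action n) T \<subseteq> {v \<in> V. ?\<kappa> v = 0}"
    unfolding fixed_sum_def by (intro cfun.span_minimal) auto
next
  let ?U = "fixed_sum V (xi_action n) T"
  have U: "cfun.subspace ?U" unfolding fixed_sum_def by (rule cfun.subspace_span)
  have Yp: "p permutes {1..n}" if "p \<in> generate (sym_group n) T" for p
    using that unfolding T(2) by (simp add: young_subgroup_def sym_group_carrier)
  have mod_U_transposition: "xi_action n \<tau> v - cscale (of_int (sign \<tau>)) v \<in> ?U"
    if "\<tau> \<in> T" "v \<in> V" for \<tau> v
  proof -
    have "\<tau> \<in> transpositions n" using that T by blast
    note \<tau> = transpositionsD[OF this]
    \<comment> \<open>The sign of \<tau> is -1, so the difference in question is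
      \<open>\<tau> v + v\<close>, which the involution \<tau> fixes.\<close>
    have "xi_action n \<tau> (xi_action n \<tau> v + v) = xi_action n \<tau> v + v"
      unfolding xi_action_add xi_action_comp[OF \<tau>(1) \<tau>(1), symmetric] \<tau>(2)
      using xi_action_id[OF supp[OF that(2)]] by (simp add: add.commute)
    moreover have "xi_action n \<tau> v + v \<in> V"
      by (rule cfun.subspace_add[OF V(1) V(2)[OF \<tau>(1) that(2)] that(2)])
    ultimately have "xi_action n \<tau> v + v \<in> ?U"
      unfolding fixed_sum_def using that(1) by (intro cfun.span_base) blast
    moreover have "xi_action n \<tau> v - cscale (of_int (sign \<tau>)) v = xi_action n \<tau> v + v"
      by (simp add: \<tau>(4) fun_eq_iff)
    ultimately show ?thesis by (simp only:)
  qed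
  have mod_U: "xi_action n p v - cscale (of_int (sign p)) v \<in> ?U"
    if "p \<in> generate (sym_group n) T" "v \<in> V" for p v
    using that
  proof (induction arbitrary: v rule: generate.induct)
    case one
    have "xi_action n id v = v" by (rule xi_action_id) (rule supp[OF one])
    then show ?case
      using cfun.subspace_0[OF U] by (simp only: sym_group_one sign_id of_int_1 cfun.scale_one diff_self)
  next
    case (incl \<tau>)
    then show ?case by (rule mod_U_transposition)
  next
    case (inv \<tau>)
    have "inv\<^bsub>sym_group n\<^esub> \<tau> = \<tau>"
      using transpositionsD(1,3)[of \<tau> n] inv(1) T(1) by (auto simp: sym_group_carrier)
    then show ?case using mod_U_transposition[OF inv] by (simp only:)
  next
    case (eng p q)
    note p = Yp[OF eng.hyps(1)] and q = Yp[OF eng.hyps(2)]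
    \<comment> \<open>The claim for p is applied at the vector \<open>q v\<close>, which is why v is
      arbitrary in the induction.\<close>
    have "(xi_action n p (xi_action n q v) - cscale (of_int (sign p)) (xi_action n q v)) +
        cscale (of_int (sign p)) (xi_action n q v - cscale (of_int (sign q)) v) \<in> ?U"
      by (intro cfun.subspace_add[OF U] cfun.subspace_scale[OF U] eng.IH V(2)[OF q] eng.prems)
    also have "(xi_action n p (xi_action n q v) - cscale (of_int (sign p)) (xi_action n q v)) +
        cscale (of_int (sign p)) (xi_action n q v - cscale (of_int (sign q)) v)
      = xi_action n (p \<circ> q) v - cscale (of_int (sign (p \<circ> q))) v"
      unfolding sign_comp_permutes[OF p q] xi_action_comp[OF p q]
      by (simp add: fun_eq_iff algebra_simps)
    finally show ?case by (simp only: sym_group_mult)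
  qed
  show "{v \<in> V. ?\<kappa> v = 0} \<subseteq> ?U"
  proof
    fix v assume "v \<in> {v \<in> V. ?\<kappa> v = 0}"
    then have v: "v \<in> V" "?\<kappa> v = 0" by auto
    define N :: complex where "N = of_nat (card (young_subgroup n \<beta>))"
    have "card (young_subgroup n \<beta>) \<noteq> 0"
      using id_in_young_subgroup[of n \<beta>] by (auto simp del: id_in_young_subgroup)
    then have N: "N \<noteq> 0" by (simp add: N_def)
    \<comment> \<open>Signs square to 1, so this combination of elements of \<open>?U\<close> equals
      \<open>?\<kappa> v - N v\<close>; as \<open>?\<kappa> v = 0\<close>, division by -N returns
      v.\<close>
    have "(\<Sum>p\<in>young_subgroup n \<beta>. cscale (of_int (sign p))
        (xi_action n p v - cscale (of_int (sign p)) v)) \<in> ?U"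
      using mod_U[OF _ v(1)] unfolding T(2)
      by (intro cfun.subspace_sum[OF U] cfun.subspace_scale[OF U])
    also have "(\<Sum>p\<in>young_subgroup n \<beta>. cscale (of_int (sign p))
        (xi_action n p v - cscale (of_int (sign p)) v)) = ?\<kappa> v - cscale N v"
      by (simp add: fun_eq_iff sum_apply algebra_simps sum_subtractf N_def)
    finally have "cscale (- (1 / N)) (?\<kappa> v - cscale N v) \<in> ?U"
      by (rule cfun.subspace_scale[OF U])
    also have "cscale (- (1 / N)) (?\<kappa> v - cscale N v) = v"
      unfolding v(2) using N by (simp add: fun_eq_iff)
    finally show "v \<in> ?U" .
  qed
qed

text \<open>A set partition contributes to the intrinsic arrangement only through some generating
  set of transpositions. All transpositions inside blocks will do.\<close>

lemma ex_generating_transpositions: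
  assumes \<beta>: "partition_on {1..n} \<beta>"
  shows "\<exists>T. T \<subseteq> transpositions n \<and> generate (sym_group n) T = young_subgroup n \<beta>"
proof -
  define T where "T = {transpose a b | a b. a \<noteq> b \<and> (\<exists>B\<in>\<beta>. a \<in> B \<and> b \<in> B)}"
  have sub: "B \<subseteq> {1..n}" if "B \<in> \<beta>" for B using \<beta> that by (auto simp: partition_on_def)
  have block_eqI: "B = C" if "B \<in> \<beta>" "C \<in> \<beta>" "x \<in> B" "x \<in> C" for B C x
    using \<beta> that by (auto simp: partition_on_def disjoint_def)
  have T: "T \<subseteq> transpositions n"
    unfolding T_def transpositions_def using sub by blast
  have TY: "\<tau> \<in> young_subgroup n \<beta>" if \<tau>T: "\<tau> \<in> T" for \<tau>
  proof -
    obtain a b B where \<tau>: "\<tau> = transpose a b" "B \<in> \<beta>" "a \<in> B" "b \<in> B"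
      using \<tau>T unfolding T_def by blast
    have "\<tau> ` C = C" if "C \<in> \<beta>" for C
    proof (cases "C = B")
      case True
      then have "\<tau> permutes C" unfolding \<tau>(1) using \<tau> by (intro permutes_swap_id) auto
      then show ?thesis by (rule permutes_image)
    next
      case False
      then have "a \<notin> C" "b \<notin> C" using block_eqI \<tau> that by blast+
      then have "\<tau> x = x" if "x \<in> C" for x
        unfolding \<tau>(1) using that by (intro transpose_apply_other) auto
      then show ?thesis by simp
    qed
    then show ?thesis
      using transpositionsD(1) T \<tau>T by (auto simp: young_subgroup_def sym_group_carrier)
  qed
  have "generate (sym_group n) T \<subseteq> young_subgroup n \<beta>"
  proof
    fix p assume "p \<in> generate (sym_group n) T"
    then show "p \<in> young_subgroup n \<beta>"
    proof (induction rule: generate.induct)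
      case (inv \<tau>)
      have "\<tau> \<in> transpositions n" using inv T by blast
      then have "inv\<^bsub>sym_group n\<^esub> \<tau> = \<tau>"
        using transpositionsD(1,3) by (simp add: sym_group_carrier)
      then show ?case using TY[OF inv] by simp
    qed (simp_all only: TY sym_group_one sym_group_mult young_subgroup_comp id_in_young_subgroup)
  qed
  moreover have gen: "p \<in> generate (sym_group n) T"
    if "finite S" "p permutes S" "S \<subseteq> {1..n}"
      "\<And>x B. B \<in> \<beta> \<Longrightarrow> x \<in> B \<Longrightarrow> p x \<in> B" for S p
    using that
  proof (induction S arbitrary: p rule: finite_induct)
    case empty
    then have "p = id" by simp
    then show ?case using generate.one[of "sym_group n" T] by (simp only: sym_group_one)
  next
    case (insert x S)
    \<comment> \<open>This fixes x and so has support in the smaller set. It still preserves the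
      blocks, since x and \<open>p x\<close> lie in a common block.\<close>
    let ?r = "transpose x (p x) \<circ> p"
    have "x \<in> \<Union>\<beta>" using insert.prems(2) \<beta> by (auto simp: partition_on_def)
    then obtain B where B: "B \<in> \<beta>" "x \<in> B" by blast
    have pB: "p x \<in> B" using insert.prems(3) B by blast
    have "?r y \<in> C" if "C \<in> \<beta>" "y \<in> C" for C y
    proof -
      have "p y \<in> C" using insert.prems(3) that by blast
      then show ?thesis
        using block_eqI[OF B(1) that(1), of x] block_eqI[OF B(1) that(1), of "p x"] B(2) pB
        by (auto simp: transpose_def)
    qed
    then have r: "?r \<in> generate (sym_group n) T"
      using insert.prems by (intro insert.IH permutes_insert_lemma) auto
    show ?case
    proof (cases "p x = x")
      case True
      then show ?thesis using r by simp
    next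
      case False
      have "transpose x (p x) \<in> T"
        unfolding T_def mem_Collect_eq
        by (intro exI[of _ x] exI[of _ "p x"] conjI bexI[of _ B] refl B pB) (use False in simp)
      from generate.eng[OF generate.incl[OF this] r]
      show ?thesis by (simp only: sym_group_mult o_assoc transpose_comp_involutory id_comp)
    qed
  qed
  have "young_subgroup n \<beta> \<subseteq> generate (sym_group n) T"
    by (auto simp: young_subgroup_def sym_group_carrier intro!: gen[of "{1..n}"])
  ultimately show ?thesis using T by blast
qed


section \<open>The embedding of the Specht module\<close>

context labelled_partition
begin

abbreviation "S \<equiv> specht n lam"
abbreviation "M \<equiv> xi_space n \<alpha> \<iota>"
abbreviation "e \<equiv> polytabloid n lam t"

text \<open>Transitivity on tableaux. It shows that the pairings with the translates of
  \<open>e\<close> comprise the pairings with all polytabloids.\<close>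

lemma ex_tableau_eq_comp_t:
  assumes s: "s \<in> tableaux n lam"
  shows "\<exists>g. g permutes {1..n} \<and> (\<forall>b\<in>boxes lam. g (t b) = s b)"
proof -
  note bt = tableauxD[OF t_tableau] and bs = tableauxD[OF s]
  define g where "g = restrict_id (s \<circ> inv_into (boxes lam) t) {1..n}"
  have "g permutes {1..n}"
    unfolding g_def by (intro permutes_restrict_id bij_betw_trans[OF bij_betw_inv_into[OF bt] bs])
  moreover have "g (t b) = s b" if "b \<in> boxes lam" for b
    using that bij_betwE[OF bt] bij_betw_inv_into_left[OF bt that] by (simp add: g_def)
  ultimately show ?thesis by blast
qed

lemma stabilizer_permutes: "w \<in> W \<Longrightarrow> w permutes {1..n}"
  by (simp add: stabilizer_def sym_group_carrier)

lemma column_group_in_stabilizer: "p \<in> column_group n lam t \<Longrightarrow> p \<in> W"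
  unfolding column_group_t young_subgroup_def stabilizer_def by (auto simp: image_iff)

lemma \<chi>_square: "\<chi> w * \<chi> w = 1"
  unfolding wreath_character_def prod.distrib[symmetric] by simp

lemma inverse_\<chi>: "inverse (\<chi> w) = \<chi> w"
  using \<chi>_square by (rule inverse_unique)

text \<open>The polytabloid of \<open>p \<circ> t\<close> is computed in two ways, by the character
  and by the sign; as \<open>e\<close> is nonzero, the scalars agree.\<close>

lemma \<chi>_column_group:
  assumes p: "p \<in> column_group n lam t"
  shows "\<chi> p = of_int (sign p)"
proof -
  have "cscale (\<chi> p) e = cscale (of_int (sign p)) e"
    using polytabloid_stabilizer[OF column_group_in_stabilizer[OF p]] polytabloid_column_group[OF p]
      tabloid_action_polytabloid[OF column_groupD(1)[OF p]] by simp
  from fun_cong[OF this, of "tabloid lam t"] show ?thesis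
    by (simp add: polytabloid_apply_self[OF t_tableau])
qed

lemma id_in_stabilizer: "id \<in> W"
  by (rule column_group_in_stabilizer) simp

lemma \<chi>_id: "\<chi> id = 1"
  by (simp add: \<chi>_column_group)

text \<open>The tableaux \<open>w \<circ> t\<close> and \<open>t\<close> have one antisymmetrizer.
  Its rank-one form, written for both, shows that \<open>\<chi> w\<close> times the left pairing is
  the right one, and \<open>\<chi> w\<close> is its own inverse.\<close>

lemma pairing_stabilizer:
  assumes w: "w \<in> W" and v: "v \<in> S"
  shows "polytabloid_pairing n lam (w \<circ> t) v = \<chi> w * polytabloid_pairing n lam t v"
proof -
  have "cscale (polytabloid_pairing n lam (w \<circ> t) v) (polytabloid n lam (w \<circ> t))
      = antisymmetrize n lam (w \<circ> t) v"
    by (rule antisymmetrize_specht[OF ip comp_in_tableaux[OF t_tableau stabilizer_permutes[OF w]] v, symmetric])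
  also have "\<dots> = antisymmetrize n lam t v"
    unfolding antisymmetrize_def column_group_stabilizer[OF w] column_group_t ..
  also have "\<dots> = cscale (polytabloid_pairing n lam t v) e"
    by (rule antisymmetrize_specht[OF ip t_tableau v])
  finally have "polytabloid_pairing n lam (w \<circ> t) v * \<chi> w = polytabloid_pairing n lam t v"
    unfolding polytabloid_stabilizer[OF w]
    by (drule_tac x = "tabloid lam t" in fun_cong) (simp add: polytabloid_apply_self[OF t_tableau])
  then show ?thesis using \<chi>_square[of w] by (metis mult.assoc mult.commute mult_1)
qed

text \<open>The zeros outside \<open>S\<close> and outside the symmetric group are the
  normalisations demanded by \<open>intertwiners\<close> and \<open>induced_space\<close>.\<close>

definition emb :: "(nat set list \<Rightarrow> complex) \<Rightarrow> (nat \<Rightarrow> nat) \<Rightarrow> complex"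
  where "emb v = (\<lambda>g. if v \<in> S \<and> g permutes {1..n} then polytabloid_pairing n lam (g \<circ> t) v else 0)"

lemma emb_apply:
  "v \<in> S \<Longrightarrow> g permutes {1..n} \<Longrightarrow> emb v g = polytabloid_pairing n lam (g \<circ> t) v"
  by (simp add: emb_def)

lemma emb_comp_stabilizer:
  assumes v: "v \<in> S" and g: "g permutes {1..n}" and w: "w \<in> W"
  shows "emb v (g \<circ> w) = \<chi> w * emb v g"
proof -
  note gw = permutes_compose[OF stabilizer_permutes[OF w] g]
  have Av: "tabloid_action (inv' g) v \<in> S" by (rule tabloid_action_specht[OF permutes_inv[OF g] v])
  show ?thesis
    unfolding emb_apply[OF v gw] emb_apply[OF v g] o_assoc[symmetric]
    unfolding polytabloid_pairing_action[OF g] pairing_stabilizer[OF w Av] ..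
qed

lemma emb_in_xi_space:
  assumes "v \<in> S"
  shows "emb v \<in> M"
  unfolding induced_space_def mem_Collect_eq
  using emb_comp_stabilizer[OF assms]
  by (auto simp: sym_group_carrier sym_group_mult inverse_\<chi> emb_def)

lemma emb_action:
  assumes h: "h permutes {1..n}" and v: "v \<in> S"
  shows "emb (tabloid_action h v) = xi_action n h (emb v)"
proof
  fix g
  have hv: "tabloid_action h v \<in> S" by (rule tabloid_action_specht[OF h v])
  show "emb (tabloid_action h v) g = xi_action n h (emb v) g"
  proof (cases "g permutes {1..n}")
    case True
    have hg: "inv' h \<circ> g permutes {1..n}" by (rule permutes_compose[OF True permutes_inv[OF h]])
    show ?thesis
      unfolding xi_action_apply[OF h True] emb_apply[OF hv True] emb_apply[OF v hg] o_assoc[symmetric]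
      unfolding polytabloid_pairing_action[OF permutes_inv[OF h]] permutes_inv_inv[OF h] ..
  next
    case False
    then show ?thesis by (simp add: emb_def induced_action_def sym_group_carrier)
  qed
qed

lemma emb_intertwiner: "emb \<in> intertwiners G S tabloid_action M (xi_action n)"
proof -
  have "emb (u + v) = emb u + emb v" if "u \<in> S" "v \<in> S" for u v
    using that cfun.subspace_add[OF subspace_specht that]
    by (auto simp: emb_def polytabloid_pairing_add fun_eq_iff)
  moreover have "emb (cscale c v) = cscale c (emb v)" if "v \<in> S" for c v
    using that cfun.subspace_scale[OF subspace_specht that]
    by (auto simp: emb_def polytabloid_pairing_cscale fun_eq_iff)
  moreover have "emb v = 0" if "v \<notin> S" for v
    using that by (simp add: emb_def fun_eq_iff)
  moreover have "emb (tabloid_action g v) = xi_action n g (emb v)" if "g \<in> carrier G" "v \<in> S" for g v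
    using that by (simp only: sym_group_carrier emb_action)
  ultimately show ?thesis
    unfolding intertwiners_def using emb_in_xi_space by blast
qed

lemma emb_eq_zero_iff:
  assumes v: "v \<in> S"
  shows "emb v = 0 \<longleftrightarrow> v = 0"
proof
  assume emb: "emb v = 0"
  show "v = 0"
  proof (rule specht_eq_zero[OF v])
    fix s assume "s \<in> tableaux n lam"
    from ex_tableau_eq_comp_t[OF this]
    obtain g where g: "g permutes {1..n}" "\<forall>b\<in>boxes lam. g (t b) = s b" by blast
    have "polytabloid_pairing n lam s v = polytabloid_pairing n lam (g \<circ> t) v"
      using g(2) by (intro polytabloid_pairing_cong) simp
    also have "\<dots> = emb v g" by (rule emb_apply[OF v g(1), symmetric])
    finally show "polytabloid_pairing n lam s v = 0" unfolding emb by simp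
  qed
qed (simp add: intertwiner_zero[OF emb_intertwiner subspace_specht])

lemma inj_on_emb: "inj_on emb S"
proof (rule inj_onI)
  fix u v assume u: "u \<in> S" and v: "v \<in> S" and eq: "emb u = emb v"
  have d1: "cscale (- 1) v \<in> S" by (rule cfun.subspace_scale[OF subspace_specht v])
  have d2: "u + cscale (- 1) v \<in> S" by (rule cfun.subspace_add[OF subspace_specht u d1])
  have "emb (u + cscale (- 1) v) = 0"
    unfolding intertwinersD(2)[OF emb_intertwiner u d1] intertwinersD(3)[OF emb_intertwiner v] eq
    by (simp add: fun_eq_iff)
  then have "u + cscale (- 1) v = 0" using emb_eq_zero_iff[OF d2] by simp
  then show "u = v" by (simp add: fun_eq_iff)
qed

lemma e_in_specht: "e \<in> S"
  by (rule polytabloid_in_specht[OF t_tableau])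

lemma emb_e_nonzero: "emb e \<noteq> 0"
  using emb_eq_zero_iff[OF e_in_specht] polytabloid_nonzero[OF t_tableau] by simp

lemma xi_space_outside: "F \<in> M \<Longrightarrow> \<not> g permutes {1..n} \<Longrightarrow> F g = 0"
  by (simp add: induced_space_def sym_group_carrier)

lemma xi_space_comp: "F \<in> M \<Longrightarrow> g permutes {1..n} \<Longrightarrow> w \<in> W \<Longrightarrow> F (g \<circ> w) = \<chi> w * F g"
  by (simp add: induced_space_def sym_group_carrier sym_group_mult inverse_\<chi>)

text \<open>
  By Frobenius reciprocity an intertwiner is determined by the functional \<open>\<lambda>v. f v id\<close>, which the
  column group multiplies by the sign, so that it factors through the antisymmetrizer.
\<close>

lemma intertwiner_eq_cscale_emb:
  assumes f: "f \<in> intertwiners G S tabloid_action M (xi_action n)"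
  shows "\<exists>c. f = (\<lambda>v. cscale c (emb v))"
proof -
  let ?C = "column_group n lam t"
  define N :: complex where "N = of_nat (card ?C)"
  have "card ?C \<noteq> 0" using id_in_column_group[of n lam t] by (auto simp del: id_in_column_group)
  then have N: "N \<noteq> 0" by (simp add: N_def)
  \<comment> \<open>Evaluating f at id on the antisymmetrized u gives
    \<open>\<langle>u, e\<rangle> f(e)(id)\<close> by the rank-one formula, and
    \<open>N f(u)(id)\<close> term by term.\<close>
  define c where "c = f e id / N"
  have at_id: "f u id = c * polytabloid_pairing n lam t u" if u: "u \<in> S" for u
  proof -
    have Au: "tabloid_action p u \<in> S" if "p \<in> ?C" for p
      by (rule tabloid_action_specht[OF column_groupD(1)[OF that] u])
    have "polytabloid_pairing n lam t u * f e id = f (cscale (polytabloid_pairing n lam t u) e) id"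
      unfolding intertwinersD(3)[OF f e_in_specht] by simp
    also have "\<dots> = f (antisymmetrize n lam t u) id"
      unfolding antisymmetrize_specht[OF ip t_tableau u] ..
    also have "f (antisymmetrize n lam t u) = (\<Sum>p\<in>?C. f (cscale (of_int (sign p)) (tabloid_action p u)))"
      unfolding antisymmetrize_def
      by (intro intertwiner_sum[OF f subspace_specht] cfun.subspace_scale[OF subspace_specht] Au)
    also have "\<dots> id = (\<Sum>p\<in>?C. f u id)"
      unfolding sum_apply
    proof (rule sum.cong[OF refl])
      fix p assume p: "p \<in> ?C"
      note pp = column_groupD(1)[OF p]
      have "f (tabloid_action p u) = xi_action n p (f u)"
        using pp by (intro intertwinersD(4)[OF f _ u]) (simp add: sym_group_carrier)
      then have "f (tabloid_action p u) id = f u (id \<circ> inv' p)"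
        by (simp add: xi_action_apply[OF pp permutes_id])
      also have "\<dots> = of_int (sign p) * f u id"
        unfolding xi_space_comp[OF intertwinersD(1)[OF f u] permutes_id column_group_in_stabilizer[OF column_group_inv[OF p]]]
          \<chi>_column_group[OF column_group_inv[OF p]] sign_inv_permutes[OF pp] ..
      finally show "f (cscale (of_int (sign p)) (tabloid_action p u)) id = f u id"
        unfolding intertwinersD(3)[OF f Au[OF p]] by simp
    qed
    also have "\<dots> = N * f u id" by (simp add: N_def)
    finally have eq: "polytabloid_pairing n lam t u * f e id = N * f u id" .
    have "f u id = N * f u id / N" using N by (rule nonzero_mult_div_cancel_left[symmetric])
    also have "\<dots> = c * polytabloid_pairing n lam t u"
      unfolding eq[symmetric] c_def times_divide_eq_left by (simp only: mult.commute)
    finally show ?thesis .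
  qed
  have "f v = cscale c (emb v)" for v
  proof (cases "v \<in> S")
    case v: True
    show ?thesis
    proof
      fix g
      show "f v g = cscale c (emb v) g"
      proof (cases "g permutes {1..n}")
        case g: True
        note g' = permutes_inv[OF g]
        have Av: "tabloid_action (inv' g) v \<in> S" by (rule tabloid_action_specht[OF g' v])
        have "f (tabloid_action (inv' g) v) = xi_action n (inv' g) (f v)"
          using g' by (intro intertwinersD(4)[OF f _ v]) (simp add: sym_group_carrier)
        then have "f v g = f (tabloid_action (inv' g) v) id"
          by (simp add: xi_action_apply[OF g' permutes_id] permutes_inv_inv[OF g])
        then show ?thesis
          unfolding at_id[OF Av] cscale_apply emb_apply[OF v g] polytabloid_pairing_action[OF g] .
      next
        case False
        then show ?thesis
          using xi_space_outside[OF intertwinersD(1)[OF f v]] by (simp add: emb_def)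
      qed
    qed
  next
    case False
    then show ?thesis
      using intertwinersD(5)[OF f] intertwinersD(5)[OF emb_intertwiner] by simp
  qed
  then show ?thesis by blast
qed

lemma multiplicity_specht:
  "multiplicity_in G S tabloid_action M (xi_action n) = 1"
proof -
  interpret op: vector_space "scale_fun cscale :: complex \<Rightarrow>
      ((nat set list \<Rightarrow> complex) \<Rightarrow> (nat \<Rightarrow> nat) \<Rightarrow> complex) \<Rightarrow> _"
    by (rule vector_space_scale_fun[OF cfun.vector_space_axioms])
  have "intertwiners G S tabloid_action M (xi_action n) \<subseteq> op.span {emb}"
  proof
    fix f assume "f \<in> intertwiners G S tabloid_action M (xi_action n)"
    then obtain c where "f = (\<lambda>v. cscale c (emb v))" using intertwiner_eq_cscale_emb by blast
    then have "f = scale_fun cscale c emb" by (simp only: scale_fun_def)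
    then show "f \<in> op.span {emb}" by (simp only: op.span_scale op.span_base singletonI)
  qed
  moreover have "emb \<noteq> 0" using emb_e_nonzero by auto
  then have "op.independent {emb}" by (simp add: op.dependent_single)
  ultimately show ?thesis
    unfolding multiplicity_in_def using emb_intertwiner by (intro op.dim_unique[of "{emb}"]) auto
qed

lemma subrepresentation_specht: "subrepresentation G S tabloid_action S"
  unfolding subrepresentation_def
  using subspace_specht tabloid_action_specht by (auto simp: sym_group_carrier)

lemma subspace_emb_image: "cfun.subspace (emb ` S)"
proof (rule cfun.subspaceI)
  show "0 \<in> emb ` S"
    using intertwiner_zero[OF emb_intertwiner subspace_specht] cfun.subspace_0[OF subspace_specht]
    by (metis imageI)
next
  fix x y assume "x \<in> emb ` S" "y \<in> emb ` S"
  then obtain u v where uv: "u \<in> S" "x = emb u" "v \<in> S" "y = emb v" by blast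
  show "x + y \<in> emb ` S"
    unfolding uv(2,4) intertwinersD(2)[OF emb_intertwiner uv(1,3), symmetric]
    by (intro imageI cfun.subspace_add[OF subspace_specht] uv)
next
  fix c x assume "x \<in> emb ` S"
  then obtain u where u: "u \<in> S" "x = emb u" by blast
  show "cscale c x \<in> emb ` S"
    unfolding u(2) intertwinersD(3)[OF emb_intertwiner u(1), symmetric]
    by (intro imageI cfun.subspace_scale[OF subspace_specht] u)
qed

lemma emb_image_action:
  assumes "p permutes {1..n}" "F \<in> emb ` S"
  shows "xi_action n p F \<in> emb ` S"
proof -
  obtain u where u: "u \<in> S" "F = emb u" using assms(2) by blast
  show ?thesis
    unfolding u(2) emb_action[OF assms(1) u(1), symmetric]
    by (intro imageI tabloid_action_specht[OF assms(1) u(1)])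
qed

text \<open>An isomorphism of V with \<open>S\<close>, inverted and followed by the inclusion into
  \<open>M\<close>, is a nonzero multiple of \<open>emb\<close>, and scaling does not change the
  image. So V is unique as a subset, not only up to isomorphism.\<close>

lemma is_pi_subspace_iff: "is_pi_subspace n lam \<alpha> \<iota> V \<longleftrightarrow> V = emb ` S"
proof
  assume V: "is_pi_subspace n lam \<alpha> \<iota> V"
  then have sub: "subrepresentation G M (xi_action n) V"
    by (simp add: is_pi_subspace_def)
  obtain f where f: "f \<in> intertwiners G V (xi_action n) S tabloid_action" "bij_betw f V S"
    using V by (auto simp: is_pi_subspace_def isomorphic_representations_def)
  define h where "h w = (if w \<in> S then inv_into V f w else 0)" for w
  have VM: "V \<subseteq> M" using sub by (simp add: subrepresentation_def)
  have "h \<in> intertwiners G S tabloid_action V (xi_action n)"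
    unfolding h_def by (rule inverse_intertwiner[OF f(1) sub f(2)])
  then have "h \<in> intertwiners G S tabloid_action M (xi_action n)"
    using VM by (auto simp: intertwiners_def)
  then obtain c where c: "h = (\<lambda>v. cscale c (emb v))" using intertwiner_eq_cscale_emb by blast
  have "inv_into V f ` S = V" using bij_betw_imp_surj_on[OF bij_betw_inv_into[OF f(2)]] .
  then have hS: "h ` S = V" by (simp add: h_def)
  have "c \<noteq> 0"
  proof
    assume "c = 0"
    then have "h ` S \<subseteq> {0}" unfolding c by auto
    then have "V \<subseteq> {0}" using hS by simp
    then have "S \<subseteq> {f 0}" using f(2) by (auto simp: bij_betw_def)
    then have "x = f 0" if "x \<in> S" for x using that by blast
    from this[OF e_in_specht] this[OF cfun.subspace_0[OF subspace_specht]] have "e = 0"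
      by (rule trans[OF _ sym])
    then show False using polytabloid_nonzero[OF t_tableau] by simp
  qed
  have "(\<lambda>v. cscale c (emb v)) ` S = emb ` S"
  proof (intro subset_antisym subsetI)
    fix x assume "x \<in> (\<lambda>v. cscale c (emb v)) ` S"
    then obtain v where v: "v \<in> S" "x = cscale c (emb v)" by blast
    show "x \<in> emb ` S" unfolding v(2)
      by (intro cfun.subspace_scale[OF subspace_emb_image] imageI v)
  next
    fix x assume "x \<in> emb ` S"
    then obtain v where v: "v \<in> S" "x = emb v" by blast
    have "x = cscale c (emb (cscale (1 / c) v))"
      unfolding v(2) intertwinersD(3)[OF emb_intertwiner v(1)] using \<open>c \<noteq> 0\<close> by (simp add: fun_eq_iff)
    moreover have "cscale (1 / c) v \<in> S" by (rule cfun.subspace_scale[OF subspace_specht v(1)])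
    ultimately show "x \<in> (\<lambda>v. cscale c (emb v)) ` S" by (rule image_eqI)
  qed
  then show "V = emb ` S" using hS unfolding c by simp
next
  assume V: "V = emb ` S"
  have emb: "emb \<in> intertwiners G S tabloid_action V (xi_action n)"
    using emb_intertwiner unfolding V intertwiners_def by auto
  have bij: "bij_betw emb S V" unfolding V using inj_on_emb by (simp add: bij_betw_def)
  have "subrepresentation G M (xi_action n) V"
    unfolding subrepresentation_def V sym_group_carrier
    using emb_in_xi_space by (intro conjI ballI subspace_emb_image emb_image_action) (auto simp: sym_group_carrier)
  moreover have "isomorphic_representations G V (xi_action n) S tabloid_action"
    unfolding isomorphic_representations_def
  proof (rule bexI[OF _ inverse_intertwiner[OF emb subrepresentation_specht bij]])
    show "bij_betw (\<lambda>w. if w \<in> V then inv_into S emb w else 0) V S"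
      using bij_betw_inv_into[OF bij] by (rule bij_betw_cong[THEN iffD1, rotated]) simp
  qed
  ultimately show "is_pi_subspace n lam \<alpha> \<iota> V" by (simp add: is_pi_subspace_def)
qed


section \<open>The two arrangements\<close>

text \<open>The antisymmetrizer of the Young subgroup of \<open>g \<alpha>\<close> is that of the
  tableau \<open>g \<circ> t\<close>. On \<open>emb v\<close> it gives \<open>emb\<close> of the
  polytabloid scaled by \<open>\<langle>v, g e\<rangle>\<close>, and this scalar is
  \<open>emb v g\<close>.\<close>

lemma fixed_sum_emb_image:
  assumes g: "g permutes {1..n}"
    and T: "T \<subseteq> transpositions n" "generate G T = young_subgroup n ((`) g ` \<alpha>)"
  shows "fixed_sum (emb ` S) (xi_action n) T = {F \<in> emb ` S. F g = 0}"
proof -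
  let ?Y = "young_subgroup n ((`) g ` \<alpha>)"
  have Y: "?Y = column_group n lam (g \<circ> t)"
    unfolding column_group_comp_t young_subgroup_def ball_simps ..
  note gt = comp_in_tableaux[OF t_tableau g]
  have "fixed_sum (emb ` S) (xi_action n) T =
      {F \<in> emb ` S. (\<Sum>p\<in>?Y. cscale (of_int (sign p)) (xi_action n p F)) = 0}"
    using emb_in_xi_space xi_space_outside
    by (intro fixed_sum_eq_kernel[OF subspace_emb_image emb_image_action _ T]) auto
  also have "(\<Sum>p\<in>?Y. cscale (of_int (sign p)) (xi_action n p F)) = 0 \<longleftrightarrow> F g = 0"
    if F: "F \<in> emb ` S" for F
  proof -
    obtain v where v: "v \<in> S" "F = emb v" using F by blast
    have Av: "tabloid_action p v \<in> S" if "p \<in> column_group n lam (g \<circ> t)" for p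
      by (rule tabloid_action_specht[OF column_groupD(1)[OF that] v(1)])
    have "(\<Sum>p\<in>?Y. cscale (of_int (sign p)) (xi_action n p F)) =
        (\<Sum>p\<in>column_group n lam (g \<circ> t). emb (cscale (of_int (sign p)) (tabloid_action p v)))"
      unfolding Y v(2)
    proof (rule sum.cong[OF refl])
      fix p assume p: "p \<in> column_group n lam (g \<circ> t)"
      show "cscale (of_int (sign p)) (xi_action n p (emb v)) = emb (cscale (of_int (sign p)) (tabloid_action p v))"
        unfolding intertwinersD(3)[OF emb_intertwiner Av[OF p]] emb_action[OF column_groupD(1)[OF p] v(1)] ..
    qed
    also have "\<dots> = emb (antisymmetrize n lam (g \<circ> t) v)"
      unfolding antisymmetrize_def
      by (intro intertwiner_sum[OF emb_intertwiner subspace_specht, symmetric]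
          cfun.subspace_scale[OF subspace_specht] Av)
    also have "\<dots> = emb (cscale (F g) (polytabloid n lam (g \<circ> t)))"
      unfolding antisymmetrize_specht[OF ip gt v(1)] v(2) emb_apply[OF v(1) g] ..
    finally have eq: "(\<Sum>p\<in>?Y. cscale (of_int (sign p)) (xi_action n p F)) =
        emb (cscale (F g) (polytabloid n lam (g \<circ> t)))" .
    have "emb (cscale (F g) (polytabloid n lam (g \<circ> t))) = 0 \<longleftrightarrow> cscale (F g) (polytabloid n lam (g \<circ> t)) = 0"
      by (intro emb_eq_zero_iff cfun.subspace_scale[OF subspace_specht] polytabloid_in_specht gt)
    also have "\<dots> \<longleftrightarrow> F g = 0"
      using polytabloid_nonzero[OF gt] by simp
    finally show ?thesis unfolding eq .
  qed
  then have "{F \<in> emb ` S. (\<Sum>p\<in>?Y. cscale (of_int (sign p)) (xi_action n p F)) = 0} = {F \<in> emb ` S. F g = 0}"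
    by (intro Collect_cong) blast
  finally show ?thesis .
qed

section \<open>Set partitions of one type as a single orbit\<close>

lemma image_in_set_partitions:
  assumes g: "g permutes {1..n}"
  shows "(`) g ` \<alpha> \<in> set_partitions n (conjugate lam)"
proof -
  have inj: "inj g" by (rule permutes_inj[OF g])
  have "\<Union>((`) g ` \<alpha>) = {1..n}"
    using Union_blocks permutes_image[OF g] by (simp flip: image_Union)
  moreover have "disjoint ((`) g ` \<alpha>)"
    using blocks_disjoint inj by (auto simp: disjoint_def image_Int[symmetric])
  moreover have "{} \<notin> (`) g ` \<alpha>"
    using part by (auto simp: partition_on_def)
  moreover have "image_mset card (mset_set ((`) g ` \<alpha>)) = mset (conjugate lam)"
  proof -
    have "inj_on ((`) g) \<alpha>" using inj by (auto simp: inj_on_def inj_image_eq_iff)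
    then have "image_mset card (mset_set ((`) g ` \<alpha>)) = image_mset (\<lambda>B. card (g ` B)) (mset_set \<alpha>)"
      by (simp flip: image_mset_mset_set add: image_mset.compositionality o_def)
    also have "\<dots> = image_mset card (mset_set \<alpha>)"
      using inj by (simp add: card_image inj_on_subset)
    also have "\<dots> = mset (map card Bs)"
      unfolding Bs(2)[symmetric] mset_set_set[OF Bs(1)] by simp
    finally show ?thesis unfolding Bs(3) .
  qed
  ultimately show ?thesis by (simp add: set_partitions_def partition_on_def)
qed

text \<open>Both partitions fill the columns of the same diagram, so the permutation between their
  tableaux carries blocks to blocks.\<close>

lemma ex_permutation_of_blocks:
  assumes "labelled_partition n lam \<beta> \<kappa> Cs"
  shows "\<exists>g. g permutes {1..n} \<and> (`) g ` \<alpha> = \<beta>"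
proof -
  interpret C: labelled_partition n lam \<beta> \<kappa> Cs by fact
  from ex_tableau_eq_comp_t[OF C.t_tableau]
  obtain g where g: "g permutes {1..n}" "\<forall>b\<in>boxes lam. g (t b) = C.t b" by blast
  have len: "length Bs = length Cs"
    using arg_cong[OF Bs(3), of length] arg_cong[OF C.Bs(3), of length] by simp
  have "map ((`) g) Bs = Cs"
  proof (rule nth_equalityI)
    fix j assume "j < length (map ((`) g) Bs)"
    then have j: "j < length Bs" "j < length Cs" using len by simp_all
    have "g ` Bs ! j = g ` t ` {b \<in> boxes lam. snd b = j}" unfolding t_column[OF j(1)] ..
    also have "\<dots> = C.t ` {b \<in> boxes lam. snd b = j}"
      unfolding image_image using g(2) by (intro image_cong) auto
    also have "\<dots> = Cs ! j" by (rule C.t_column[OF j(2)])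
    finally show "map ((`) g) Bs ! j = Cs ! j" using j by simp
  qed (simp add: len)
  then have "(`) g ` \<alpha> = \<beta>" unfolding Bs(2)[symmetric] C.Bs(2)[symmetric] by (metis set_map)
  then show ?thesis using g(1) by blast
qed

end

lemma ex_labelled_partition:
  assumes "integer_partition n lam" "\<alpha> \<in> set_partitions n (conjugate lam)" "block_labelling \<alpha> \<iota>"
  shows "\<exists>Bs. labelled_partition n lam \<alpha> \<iota> Bs"
proof -
  have part: "partition_on {1..n} \<alpha>" and "image_mset card (mset_set \<alpha>) = mset (conjugate lam)"
    using assms(2) by (auto simp: set_partitions_def)
  from ex_list_of_image_mset[OF this(2)]
  obtain Bs where Bs: "mset Bs = mset_set \<alpha>" "map card Bs = conjugate lam" by blast
  have "\<alpha> \<subseteq> Pow {1..n}" using part by (auto simp: partition_on_def)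
  then have "finite \<alpha>" by (rule finite_subset) simp
  then have "set Bs = \<alpha>" using Bs(1) by (metis finite_set_mset_mset_set set_mset_mset)
  moreover have "distinct Bs"
    using Bs(1) by (simp add: distinct_count_atmost_1 count_mset_set' flip: \<open>set Bs = \<alpha>\<close>)
  ultimately show ?thesis
    using assms(1,3) part Bs(2) by (auto simp: labelled_partition_def)
qed

lemma ex_block_labelling:
  assumes "partition_on {1..n} \<beta>"
  shows "\<exists>\<kappa>. block_labelling \<beta> \<kappa>"
proof -
  have "\<exists>h. bij_betw h {..<card B} B" if "B \<in> \<beta>" for B
  proof -
    have "B \<subseteq> {1..n}" using assms that by (auto simp: partition_on_def)
    then have "finite B" by (rule finite_subset) simp
    then show ?thesis using ex_bij_betw_nat_finite[of B] by (simp add: atLeast0LessThan)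
  qed
  then have "\<exists>\<kappa>. \<forall>B\<in>\<beta>. bij_betw (\<kappa> B) {..<card B} B" by (rule bchoice[OF ballI])
  then show ?thesis by (simp add: block_labelling_def)
qed

context labelled_partition
begin

lemma intrinsic_arrangement_emb_image:
  "intrinsic_arrangement n lam (emb ` S) (xi_action n) =
    {{F \<in> emb ` S. F g = 0} | g. g permutes {1..n}}"
proof (intro subset_antisym subsetI)
  fix H assume "H \<in> intrinsic_arrangement n lam (emb ` S) (xi_action n)"
  then obtain \<beta> T where H: "H = fixed_sum (emb ` S) (xi_action n) T"
    and \<beta>: "\<beta> \<in> set_partitions n (conjugate lam)"
    and T: "T \<subseteq> transpositions n" "generate G T = young_subgroup n \<beta>"
    unfolding intrinsic_arrangement_def mem_Collect_eq by (elim exE conjE) (rule that)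
  have "partition_on {1..n} \<beta>" using \<beta> by (simp add: set_partitions_def)
  \<comment> \<open>Any labelling of \<beta> serves here: it only supplies a tableau whose columns
    are the blocks of \<beta>.\<close>
  from ex_block_labelling[OF this] obtain \<kappa> where \<kappa>: "block_labelling \<beta> \<kappa>" ..
  from ex_labelled_partition[OF ip \<beta> \<kappa>] obtain Cs where "labelled_partition n lam \<beta> \<kappa> Cs" ..
  from ex_permutation_of_blocks[OF this]
  obtain g where g: "g permutes {1..n}" "(`) g ` \<alpha> = \<beta>" by blast
  have "H = {F \<in> emb ` S. F g = 0}"
    unfolding H using T g by (intro fixed_sum_emb_image) simp_all
  then show "H \<in> {{F \<in> emb ` S. F g = 0} | g. g permutes {1..n}}" using g(1) by blast
next
  fix H assume "H \<in> {{F \<in> emb ` S. F g = 0} | g. g permutes {1..n}}"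
  then obtain g where g: "g permutes {1..n}" and H: "H = {F \<in> emb ` S. F g = 0}" by blast
  let ?\<beta> = "(`) g ` \<alpha>"
  have \<beta>: "?\<beta> \<in> set_partitions n (conjugate lam)" by (rule image_in_set_partitions[OF g])
  then have "partition_on {1..n} ?\<beta>" by (simp add: set_partitions_def)
  from ex_generating_transpositions[OF this]
  obtain T where T: "T \<subseteq> transpositions n" "generate G T = young_subgroup n ?\<beta>" by blast
  have "H = fixed_sum (emb ` S) (xi_action n) T"
    unfolding H by (rule fixed_sum_emb_image[OF g T, symmetric])
  then show "H \<in> intrinsic_arrangement n lam (emb ` S) (xi_action n)"
    unfolding intrinsic_arrangement_def mem_Collect_eq using \<beta> T
    by (intro exI[of _ ?\<beta>] exI[of _ T] conjI)
qed

section \<open>Coordinates relative to coset representatives\<close>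

lemma coset_permutes: "\<lbrakk>g permutes {1..n}; x \<in> g <#\<^bsub>G\<^esub> W\<rbrakk> \<Longrightarrow> x permutes {1..n}"
  using stabilizer_permutes by (auto simp: l_coset_def sym_group_mult intro: permutes_compose)

context
  fixes R
  assumes R: "coset_representatives G W R"
begin

lemma R_permutes: "g \<in> R \<Longrightarrow> g permutes {1..n}"
  using R by (auto simp: coset_representatives_def sym_group_carrier)

lemma R_unique: "\<lbrakk>g \<in> R; h \<in> R; x \<in> g <#\<^bsub>G\<^esub> W; x \<in> h <#\<^bsub>G\<^esub> W\<rbrakk> \<Longrightarrow> g = h"
proof -
  assume gh: "g \<in> R" "h \<in> R" and x: "x \<in> g <#\<^bsub>G\<^esub> W" "x \<in> h <#\<^bsub>G\<^esub> W"
  have "x \<in> carrier G"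
    using coset_permutes[OF R_permutes[OF gh(1)] x(1)] by (simp add: sym_group_carrier)
  then have "\<exists>!g. g \<in> R \<and> x \<in> g <#\<^bsub>G\<^esub> W" using R by (simp only: coset_representatives_def)
  then show "g = h" using gh x by blast
qed

lemma R_cover:
  assumes "x permutes {1..n}"
  obtains g w where "g \<in> R" "w \<in> W" "x = g \<circ> w"
proof -
  have "\<exists>g. g \<in> R \<and> x \<in> g <#\<^bsub>G\<^esub> W"
    using R assms by (auto simp: coset_representatives_def sym_group_carrier)
  then show ?thesis using that by (auto simp: l_coset_def sym_group_mult)
qed

lemma finite_R: "finite R"
  by (rule finite_subset[OF _ finite_permutations[of "{1..n}"]]) (auto intro: R_permutes)

abbreviation "basis_vec \<equiv> induced_basis_vector G W \<chi>"

lemma in_own_coset: "g \<in> g <#\<^bsub>G\<^esub> W"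
  using UN_I[OF id_in_stabilizer, of g "\<lambda>w. {g \<circ> w}"] by (simp add: l_coset_def sym_group_mult)

text \<open>The basis vectors are dual to the evaluations at the representatives. Independence and
  coordinates both follow by evaluating at elements of R.\<close>

lemma basis_vector_apply:
  assumes "g \<in> R" "h \<in> R"
  shows "basis_vec h g = (if h = g then 1 else 0)"
proof (cases "h = g")
  case True
  have "inv\<^bsub>G\<^esub> g \<otimes>\<^bsub>G\<^esub> g = id"
    using R_permutes[OF assms(1)] permutes_inv_o(2)[OF R_permutes[OF assms(1)]]
    by (simp add: sym_group_carrier sym_group_mult)
  then show ?thesis
    using True in_own_coset[of g] by (simp add: induced_basis_vector_def \<chi>_id)
next
  case False
  then have "g \<notin> h <#\<^bsub>G\<^esub> W" using R_unique[OF assms _ ] in_own_coset[of g] by blast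
  then show ?thesis using False by (simp add: induced_basis_vector_def)
qed

lemma inj_on_basis_vector: "inj_on basis_vec R"
proof (rule inj_onI)
  fix g h assume "g \<in> R" "h \<in> R" "basis_vec g = basis_vec h"
  then have "basis_vec h g = 1" using basis_vector_apply[OF \<open>g \<in> R\<close> \<open>g \<in> R\<close>] by (simp only: if_True simp_thms)
  then show "g = h" using basis_vector_apply[OF \<open>g \<in> R\<close> \<open>h \<in> R\<close>] by (simp only: if_False zero_neq_one split: if_splits)
qed

lemma sum_basis_vector_apply:
  assumes "g \<in> R"
  shows "(\<Sum>v\<in>basis_vec ` R. cscale (c v) v) g = c (basis_vec g)"
proof -
  have "(\<Sum>v\<in>basis_vec ` R. cscale (c v) v) g = (\<Sum>h\<in>R. if h = g then c (basis_vec h) else 0)"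
    unfolding sum.reindex[OF inj_on_basis_vector] sum_apply
    using basis_vector_apply[OF assms] by (intro sum.cong) auto
  then show ?thesis using assms finite_R by simp
qed

lemma independent_basis_vectors: "cfun.independent (basis_vec ` R)"
proof (rule cfun.independent_if_scalars_zero)
  fix c v assume "(\<Sum>x\<in>basis_vec ` R. cscale (c x) x) = 0" "v \<in> basis_vec ` R"
  then show "c v = 0" using sum_basis_vector_apply[of _ c] by auto
qed (simp add: finite_R)

text \<open>At x = g w only the term of the representative g survives, and it contributes
  \<open>\<chi> w * F g\<close>, the value of F at x.\<close>

lemma basis_expansion:
  assumes F: "F \<in> M"
  shows "F = (\<Sum>h\<in>R. cscale (F h) (basis_vec h))"
proof
  fix x
  show "F x = (\<Sum>h\<in>R. cscale (F h) (basis_vec h)) x"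
  proof (cases "x permutes {1..n}")
    case True
    then obtain g w where g: "g \<in> R" "w \<in> W" "x = g \<circ> w" by (rule R_cover)
    note gp = R_permutes[OF g(1)]
    have x: "x \<in> g <#\<^bsub>G\<^esub> W"
      unfolding l_coset_def sym_group_mult g(3) by (intro UN_I[OF g(2)] singletonI)
    have gx: "inv\<^bsub>G\<^esub> g \<otimes>\<^bsub>G\<^esub> x = w"
      using gp permutes_inv_o(2)[OF gp] g(3) by (simp add: sym_group_carrier sym_group_mult o_assoc)
    have bx: "basis_vec h x = (if h = g then \<chi> w else 0)" if "h \<in> R" for h
    proof (cases "h = g")
      case True
      then show ?thesis unfolding induced_basis_vector_def using x gx by (simp only: if_True simp_thms inverse_\<chi>)
    next
      case False
      then have "x \<notin> h <#\<^bsub>G\<^esub> W" using R_unique[OF g(1) that x] by metis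
      then show ?thesis unfolding induced_basis_vector_def using False by (simp only: if_False)
    qed
    have "(\<Sum>h\<in>R. cscale (F h) (basis_vec h)) x = (\<Sum>h\<in>R. if h = g then F h * \<chi> w else 0)"
      unfolding sum_apply by (intro sum.cong) (auto simp: bx)
    also have "\<dots> = F x"
      using g(1) finite_R xi_space_comp[OF F gp g(2)] g(3) by (simp add: mult.commute)
    finally show ?thesis by simp
  next
    case False
    then have "basis_vec h x = 0" if "h \<in> R" for h
      using coset_permutes[OF R_permutes[OF that]] by (auto simp: induced_basis_vector_def)
    then show ?thesis using xi_space_outside[OF F False] by (simp add: sum_apply)
  qed
qed

lemma representation_basis_vector:
  assumes F: "F \<in> M" and g: "g \<in> R"
  shows "cfun.representation (basis_vec ` R) F (basis_vec g) = F g"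
proof -
  have "F \<in> cfun.span (basis_vec ` R)"
    by (subst basis_expansion[OF F])
      (intro cfun.span_sum cfun.span_scale cfun.span_base imageI)
  then have "(\<Sum>v\<in>basis_vec ` R. cscale (cfun.representation (basis_vec ` R) F v) v) = F"
    using independent_basis_vectors finite_R by (intro cfun.sum_representation_eq) auto
  from fun_cong[OF this, of g] show ?thesis
    unfolding sum_basis_vector_apply[OF g] .
qed

text \<open>Values of F on one coset differ by nonzero factors \<open>\<chi> w\<close>, so its zeros
  are unions of cosets. Hence the index may run over all permutations, and R disappears from the
  description.\<close>

lemma restriction_coordinate_arrangement:
  assumes V: "V \<subseteq> M"
  shows "restriction (xi_coordinate_arrangement n \<alpha> \<iota> R) V = {{F \<in> V. F g = 0} | g. g permutes {1..n}}"
proof -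
  have *: "{F \<in> M. cfun.representation (basis_vec ` R) F (basis_vec g) = 0} \<inter> V = {F \<in> V. F g = 0}" if "g \<in> R" for g
    using representation_basis_vector[OF _ that] V by auto
  have "restriction (xi_coordinate_arrangement n \<alpha> \<iota> R) V = {{F \<in> V. F g = 0} | g. g \<in> R}"
  proof (intro subset_antisym subsetI)
    fix H assume "H \<in> restriction (xi_coordinate_arrangement n \<alpha> \<iota> R) V"
    then obtain g where "g \<in> R" "H = {F \<in> M. cfun.representation (basis_vec ` R) F (basis_vec g) = 0} \<inter> V"
      unfolding restriction_def coordinate_arrangement_def by blast
    then show "H \<in> {{F \<in> V. F g = 0} | g. g \<in> R}" using * by blast
  next
    fix H assume "H \<in> {{F \<in> V. F g = 0} | g. g \<in> R}"
    then obtain g where g: "g \<in> R" "H = {F \<in> V. F g = 0}" by blast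
    then have "H = {F \<in> M. cfun.representation (basis_vec ` R) F (basis_vec g) = 0} \<inter> V" using *[OF g(1)] by simp
    then show "H \<in> restriction (xi_coordinate_arrangement n \<alpha> \<iota> R) V"
      unfolding restriction_def coordinate_arrangement_def using g(1) by blast
  qed
  also have "\<dots> = {{F \<in> V. F g = 0} | g. g permutes {1..n}}"
  proof (intro subset_antisym subsetI)
    fix H assume "H \<in> {{F \<in> V. F g = 0} | g. g \<in> R}"
    then show "H \<in> {{F \<in> V. F g = 0} | g. g permutes {1..n}}" using R_permutes by blast
  next
    fix H assume "H \<in> {{F \<in> V. F g = 0} | g. g permutes {1..n}}"
    then obtain x where x: "x permutes {1..n}" "H = {F \<in> V. F x = 0}" by blast
    from x(1) obtain g w where g: "g \<in> R" "w \<in> W" "x = g \<circ> w" by (rule R_cover)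
    have "\<chi> w \<noteq> 0" using \<chi>_square[of w] by auto
    then have "F x = 0 \<longleftrightarrow> F g = 0" if "F \<in> V" for F
      unfolding g(3) xi_space_comp[OF subsetD[OF V that] R_permutes[OF g(1)] g(2)] by simp
    then have "H = {F \<in> V. F g = 0}" unfolding x(2) by blast
    then show "H \<in> {{F \<in> V. F g = 0} | g. g \<in> R}" using g(1) by blast
  qed
  finally show ?thesis .
qed

end

end


theorem theorem1:
  fixes n :: nat and lam :: "nat list"
    and \<alpha> :: "nat set set" and \<iota> :: "nat set \<Rightarrow> nat \<Rightarrow> nat"
    and R :: "(nat \<Rightarrow> nat) set"
  assumes "integer_partition n lam"
    and "\<alpha> \<in> set_partitions n (conjugate lam)"
    and "block_labelling \<alpha> \<iota>"
    and "coset_representatives (sym_group n) (stabilizer n \<alpha>) R"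
  shows "multiplicity_in (sym_group n)
           (specht n lam) tabloid_action (xi_space n \<alpha> \<iota>) (xi_action n) = 1 \<and>
         (\<exists>!V. is_pi_subspace n lam \<alpha> \<iota> V) \<and>
         (\<forall>V. is_pi_subspace n lam \<alpha> \<iota> V \<longrightarrow>
           restriction (xi_coordinate_arrangement n \<alpha> \<iota> R) V =
             intrinsic_arrangement n lam V (xi_action n))"
proof -
  from ex_labelled_partition[OF assms(1-3)] obtain Bs where "labelled_partition n lam \<alpha> \<iota> Bs" ..
  then interpret labelled_partition n lam \<alpha> \<iota> Bs .
  have "emb ` S \<subseteq> M" using emb_in_xi_space by blast
  then have "restriction (xi_coordinate_arrangement n \<alpha> \<iota> R) (emb ` S) =
      intrinsic_arrangement n lam (emb ` S) (xi_action n)"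
    unfolding intrinsic_arrangement_emb_image
    by (rule restriction_coordinate_arrangement[OF assms(4)])
  then show ?thesis
    unfolding is_pi_subspace_iff using multiplicity_specht by simp
qed

end
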